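(* (a) Let $1\le q\le\alpha\le p\le\infty$. Then $\left((L^q,L^p)^\alpha(X),\|\cdot\|_{q,p,\alpha}\right)$ is a complex Banach space, and there exists a constant $C>0$ such that $\|f\|_{q,p,\alpha}\le C\|f\|_\alpha$ for all $f\in L_0(X)$. (b) Let $1\le q\le\alpha\le p\le\infty$ and assume that $1\le q_1<q_2\le\alpha\le p_1<p_2\le\infty$. Then there is a constant $C>0$ such that for all $f\in L_0(X)$ $$\|f\|_{q_1,p,\alpha}\le C\|f\|_{q_2,p,\alpha}\qquad\text{and}\qquad \|f\|_{q,p_2,\alpha}\le C\|f\|_{q,p_1,\alpha}.$$
   Context: Setting. $(X,d,\mu)$ is a space of homogeneous type: $d$ is a quasi-metric on $X$ (with a constant $\kappa\ge 1$ such that $d(x,y)\le\kappa(d(x,z)+d(z,y))$ for all $x,y,z\in X$), and $\mu$ is a non-negative Borel measure such that, with $B(x,r)=\{y\in X: d(x,y)<r\}$, there is a constant $C$ with $0<\mu(B(x,2r))\le C\mu(B(x,r))<\infty$ for all $x\in X$, $r>0$. It is assumed moreover that all balls $B(x,r)$ are open for the $d$-topology, $(X,d)$ is separable, $\mu(X)=\infty$, and $B(x,R)\setminus B(x,r)\neq\emptyset$ for all $x\in X$ and $0<r<R<\infty$. Notation. $L_0(X)$ is the complex vector space of classes (modulo equality $\mu$-almost everywhere) of $\mu$-measurable complex-valued functions on $X$; $\|\cdot\|_s$ is the usual norm of $L^s(X)=L^s(X,\mu)$ (with value $\infty$ outside $L^s(X)$); $\chi_E$ is the characteristic function of $E$.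 For $1\le q\le\alpha\le p\le\infty$, $f\in L_0(X)$ and $r>0$ (convention $1/\infty=0$), $${}_{r}\|f\|_{q,p,\alpha}=\left[\int_X\left(\mu(B(y,r))^{\frac1\alpha-\frac1p-\frac1q}\,\|f\chi_{B(y,r)}\|_q\right)^p d\mu(y)\right]^{1/p}\quad\text{if } p<\infty,$$ $${}_{r}\|f\|_{q,\infty,\alpha}=\sup_{y\in X}\mu(B(y,r))^{\frac1\alpha-\frac1q}\,\|f\chi_{B(y,r)}\|_q\quad\text{if } p=\infty.$$ Further $\|f\|_{q,p,\alpha}=\sup_{r>0}\ {}_{r}\|f\|_{q,p,\alpha}\in[0,\infty]$ and $(L^q,L^p)^\alpha(X)=\{f\in L_0(X):\ \|f\|_{q,p,\alpha}<\infty\}$. *)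

theory Defs
  imports
    "HOL-Analysis.Analysis"
    "HOL-Probability.Essential_Supremum"
    "HOL-Algebra.Module"
begin

locale quasi_metric_space =
  fixes X :: "'a set" and d :: "'a \<Rightarrow> 'a \<Rightarrow> real"
  assumes nonneg: "\<lbrakk>x \<in> X; y \<in> X\<rbrakk> \<Longrightarrow> 0 \<le> d x y"
    and zero_iff: "\<lbrakk>x \<in> X; y \<in> X\<rbrakk> \<Longrightarrow> d x y = 0 \<longleftrightarrow> x = y"
    and commute: "\<lbrakk>x \<in> X; y \<in> X\<rbrakk> \<Longrightarrow> d x y = d y x"
    and quasi_triangle:
      "\<exists>\<kappa>\<ge>1. \<forall>x\<in>X. \<forall>y\<in>X. \<forall>z\<in>X. d x y \<le> \<kappa> * (d x z + d z y)"

definition qball :: "'a set \<Rightarrow> ('a \<Rightarrow> 'a \<Rightarrow> real) \<Rightarrow> 'a \<Rightarrow> real \<Rightarrow> 'a set" where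
  "qball X d x r = {y \<in> X. d x y < r}"

text \<open>For a quasi-metric the balls need not be open in this topology.\<close>

definition qtopology :: "'a set \<Rightarrow> ('a \<Rightarrow> 'a \<Rightarrow> real) \<Rightarrow> 'a topology" where
  "qtopology X d = topology (\<lambda>U. U \<subseteq> X \<and> (\<forall>x\<in>U. \<exists>r>0. qball X d x r \<subseteq> U))"

lemma openin_qtopology:
  "openin (qtopology X d) U \<longleftrightarrow> U \<subseteq> X \<and> (\<forall>x\<in>U. \<exists>r>0. qball X d x r \<subseteq> U)"
proof -
  have "istopology (\<lambda>U. U \<subseteq> X \<and> (\<forall>x\<in>U. \<exists>r>0. qball X d x r \<subseteq> U))"
    unfolding istopology_def
  proof (intro conjI allI impI)
    fix S T
    assume S: "S \<subseteq> X \<and> (\<forall>x\<in>S. \<exists>r>0. qball X d x r \<subseteq> S)"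
      and T: "T \<subseteq> X \<and> (\<forall>x\<in>T. \<exists>r>0. qball X d x r \<subseteq> T)"
    show "S \<inter> T \<subseteq> X" using S by blast
    show "\<forall>x\<in>S \<inter> T. \<exists>r>0. qball X d x r \<subseteq> S \<inter> T"
    proof
      fix x assume "x \<in> S \<inter> T"
      then obtain r s where rs: "r > 0" "qball X d x r \<subseteq> S" "s > 0" "qball X d x s \<subseteq> T"
        using S T by blast
      then have "qball X d x (min r s) \<subseteq> S \<inter> T" by (auto simp: qball_def)
      then show "\<exists>r>0. qball X d x r \<subseteq> S \<inter> T"
        using rs by (intro exI[of _ "min r s"]) auto
    qed
  next
    fix K
    assume K: "\<forall>S\<in>K. S \<subseteq> X \<and> (\<forall>x\<in>S. \<exists>r>0. qball X d x r \<subseteq> S)"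
    then show "\<Union> K \<subseteq> X" by blast
    show "\<forall>x\<in>\<Union> K. \<exists>r>0. qball X d x r \<subseteq> \<Union> K"
    proof
      fix x assume "x \<in> \<Union> K"
      then obtain S where S: "S \<in> K" "x \<in> S" by blast
      with K obtain r where "r > 0" "qball X d x r \<subseteq> S" by blast
      with S show "\<exists>r>0. qball X d x r \<subseteq> \<Union> K" by blast
    qed
  qed
  then show ?thesis by (simp add: qtopology_def topology_inverse')
qed

locale homogeneous_type_space = quasi_metric_space "space M" d
  for M :: "'a measure" and d :: "'a \<Rightarrow> 'a \<Rightarrow> real" +
  assumes sets_borel: "sets M = sigma_sets (space M) {U. openin (qtopology (space M) d) U}"
    and doubling: "\<exists>C::real. \<forall>x\<in>space M. \<forall>r>0.
      0 < emeasure M (qball (space M) d x (2 * r)) \<and>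
      emeasure M (qball (space M) d x (2 * r)) \<le> ennreal C * emeasure M (qball (space M) d x r) \<and>
      ennreal C * emeasure M (qball (space M) d x r) < \<infinity>"
    and openin_qball:
      "\<lbrakk>x \<in> space M; 0 < r\<rbrakk> \<Longrightarrow> openin (qtopology (space M) d) (qball (space M) d x r)"
    and separable: "separable_space (qtopology (space M) d)"
    and infinite_measure: "emeasure M (space M) = \<infinity>"
    and annulus_nonempty: "\<lbrakk>x \<in> space M; 0 < r; r < R\<rbrakk> \<Longrightarrow>
      qball (space M) d x R - qball (space M) d x r \<noteq> {}"

text \<open>Power of an extended nonnegative number; only used with exponents \<open>a > 0\<close>.\<close>

definition enn_powr :: "ennreal \<Rightarrow> real \<Rightarrow> ennreal" where
  "enn_powr x a = (if x = \<infinity> then \<infinity> else ennreal (enn2real x powr a))"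

text \<open>Reciprocal of an exponent in \<open>[1, \<infinity>]\<close>, with \<open>1 / \<infinity> = 0\<close>.\<close>

definition recip :: "ennreal \<Rightarrow> real" where
  "recip s = enn2real (inverse s)"

definition Lnorm :: "'a measure \<Rightarrow> ennreal \<Rightarrow> ('a \<Rightarrow> complex) \<Rightarrow> ennreal" where
  "Lnorm N s f =
    (if s = \<infinity> then esssup N (\<lambda>x. ennreal (cmod (f x)))
     else enn_powr (\<integral>\<^sup>+x. ennreal (cmod (f x) powr enn2real s) \<partial>N) (recip s))"

text \<open>The measurable functions considered are those measurable with respect to the completion
  of the Borel measure \<open>M\<close>, so the Lebesgue norms are taken over \<open>completion M\<close>.
  The exponent of the measure of a ball for \<open>p = \<infinity>\<close> is \<open>1/\<alpha> - 1/q\<close> since \<open>recip \<infinity> = 0\<close>.\<close>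

definition local_norm ::
  "'a measure \<Rightarrow> ('a \<Rightarrow> 'a \<Rightarrow> real) \<Rightarrow> ennreal \<Rightarrow> ennreal \<Rightarrow> ennreal \<Rightarrow> real \<Rightarrow> ('a \<Rightarrow> complex) \<Rightarrow> 'a \<Rightarrow> ennreal"
  where
  "local_norm M d q p \<alpha> r f y =
     ennreal (measure M (qball (space M) d y r) powr (recip \<alpha> - recip p - recip q)) *
     Lnorm (completion M) q (\<lambda>x. f x * indicator (qball (space M) d y r) x)"

definition amalgam_norm_at ::
  "'a measure \<Rightarrow> ('a \<Rightarrow> 'a \<Rightarrow> real) \<Rightarrow> ennreal \<Rightarrow> ennreal \<Rightarrow> ennreal \<Rightarrow> real \<Rightarrow> ('a \<Rightarrow> complex) \<Rightarrow> ennreal"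
  where
  "amalgam_norm_at M d q p \<alpha> r f =
    (if p = \<infinity> then (SUP y\<in>space M. local_norm M d q p \<alpha> r f y)
     else enn_powr (\<integral>\<^sup>+y. enn_powr (local_norm M d q p \<alpha> r f y) (enn2real p) \<partial>M) (recip p))"

definition amalgam_norm ::
  "'a measure \<Rightarrow> ('a \<Rightarrow> 'a \<Rightarrow> real) \<Rightarrow> ennreal \<Rightarrow> ennreal \<Rightarrow> ennreal \<Rightarrow> ('a \<Rightarrow> complex) \<Rightarrow> ennreal"
  where
  "amalgam_norm M d q p \<alpha> f = (SUP r\<in>{0<..}. amalgam_norm_at M d q p \<alpha> r f)"

definition ae_class :: "'a measure \<Rightarrow> ('a \<Rightarrow> complex) \<Rightarrow> ('a \<Rightarrow> complex) set" where
  "ae_class M f = {g \<in> borel_measurable (completion M). AE x in M. g x = f x}"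

definition L0 :: "'a measure \<Rightarrow> ('a \<Rightarrow> complex) set set" where
  "L0 M = ae_class M ` borel_measurable (completion M)"

definition class_add ::
  "'a measure \<Rightarrow> ('a \<Rightarrow> complex) set \<Rightarrow> ('a \<Rightarrow> complex) set \<Rightarrow> ('a \<Rightarrow> complex) set" where
  "class_add M F G = (\<Union>f\<in>F. \<Union>g\<in>G. ae_class M (\<lambda>x. f x + g x))"

definition class_smult ::
  "'a measure \<Rightarrow> complex \<Rightarrow> ('a \<Rightarrow> complex) set \<Rightarrow> ('a \<Rightarrow> complex) set" where
  "class_smult M c F = (\<Union>f\<in>F. ae_class M (\<lambda>x. c * f x))"

text \<open>The common value on a class of a quantity that does not depend on the representative.\<close>

definition on_class :: "(('a \<Rightarrow> complex) \<Rightarrow> ennreal) \<Rightarrow> ('a \<Rightarrow> complex) set \<Rightarrow> ennreal" where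
  "on_class \<phi> F = the_elem (\<phi> ` F)"

lemma self_in_ae_class: "f \<in> borel_measurable (completion M) \<Longrightarrow> f \<in> ae_class M f"
  by (simp add: ae_class_def)

lemma ae_class_cong:
  "AE x in M. f x = g x \<Longrightarrow> ae_class M f = ae_class M g"
proof -
  assume eq: "AE x in M. f x = g x"
  have "(AE x in M. h x = f x) \<longleftrightarrow> (AE x in M. h x = g x)" for h
  proof
    assume "AE x in M. h x = f x"
    with eq show "AE x in M. h x = g x" by eventually_elim simp
  next
    assume "AE x in M. h x = g x"
    with eq show "AE x in M. h x = f x" by eventually_elim simp
  qed
  then show ?thesis by (simp add: ae_class_def)
qed

lemma class_add_ae_class:
  assumes "f \<in> borel_measurable (completion M)" "g \<in> borel_measurable (completion M)"
  shows "class_add M (ae_class M f) (ae_class M g) = ae_class M (\<lambda>x. f x + g x)"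
proof -
  have "ae_class M (\<lambda>x. f' x + g' x) = ae_class M (\<lambda>x. f x + g x)"
    if "f' \<in> ae_class M f" "g' \<in> ae_class M g" for f' g'
  proof (rule ae_class_cong)
    have "AE x in M. f' x = f x" "AE x in M. g' x = g x"
      using that by (simp_all add: ae_class_def)
    then show "AE x in M. f' x + g' x = f x + g x" by eventually_elim simp
  qed
  with self_in_ae_class[OF assms(1)] self_in_ae_class[OF assms(2)]
  show ?thesis unfolding class_add_def by blast
qed

lemma class_smult_ae_class:
  assumes "f \<in> borel_measurable (completion M)"
  shows "class_smult M c (ae_class M f) = ae_class M (\<lambda>x. c * f x)"
proof -
  have "ae_class M (\<lambda>x. c * f' x) = ae_class M (\<lambda>x. c * f x)" if "f' \<in> ae_class M f" for f'
  proof (rule ae_class_cong)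
    have "AE x in M. f' x = f x" using that by (simp add: ae_class_def)
    then show "AE x in M. c * f' x = c * f x" by eventually_elim simp
  qed
  with self_in_ae_class[OF assms] show ?thesis unfolding class_smult_def by blast
qed

lemma on_class_ae_class:
  assumes "f \<in> borel_measurable (completion M)"
    and "\<And>g. g \<in> ae_class M f \<Longrightarrow> \<phi> g = \<phi> f"
  shows "on_class \<phi> (ae_class M f) = \<phi> f"
proof -
  have "\<phi> ` ae_class M f = {\<phi> f}" using assms(2) self_in_ae_class[OF assms(1)] by blast
  then show ?thesis by (simp add: on_class_def)
qed

lemma Lnorm_cong_AE:
  assumes "f \<in> borel_measurable N" "g \<in> borel_measurable N" "AE x in N. f x = g x"
  shows "Lnorm N s f = Lnorm N s g"
proof -
  have "esssup N (\<lambda>x. ennreal (cmod (f x))) = esssup N (\<lambda>x. ennreal (cmod (g x)))"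
  proof (rule esssup_AE_cong)
    show "(\<lambda>x. ennreal (cmod (f x))) \<in> borel_measurable N"
      "(\<lambda>x. ennreal (cmod (g x))) \<in> borel_measurable N"
      using assms(1,2) by measurable
    show "AE x in N. ennreal (cmod (f x)) = ennreal (cmod (g x))"
      using assms(3) by eventually_elim simp
  qed
  moreover have "(\<integral>\<^sup>+x. ennreal (cmod (f x) powr enn2real s) \<partial>N)
      = (\<integral>\<^sup>+x. ennreal (cmod (g x) powr enn2real s) \<partial>N)"
  proof (rule nn_integral_cong_AE)
    show "AE x in N. ennreal (cmod (f x) powr enn2real s) = ennreal (cmod (g x) powr enn2real s)"
      using assms(3) by eventually_elim simp
  qed
  ultimately show ?thesis by (simp add: Lnorm_def)
qed

lemma on_class_Lnorm:
  assumes "f \<in> borel_measurable (completion M)"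
  shows "on_class (Lnorm (completion M) s) (ae_class M f) = Lnorm (completion M) s f"
  using assms
  by (intro on_class_ae_class Lnorm_cong_AE) (auto simp: ae_class_def intro: AE_completion)

lemma (in homogeneous_type_space) qball_in_sets:
  assumes "y \<in> space M" "0 < r"
  shows "qball (space M) d y r \<in> sets M"
  using openin_qball[OF assms] unfolding sets_borel by (intro sigma_sets.Basic) simp

lemma (in homogeneous_type_space) amalgam_norm_cong_AE:
  assumes f: "f \<in> borel_measurable (completion M)" and g: "g \<in> borel_measurable (completion M)"
    and eq: "AE x in M. f x = g x"
  shows "amalgam_norm M d q p \<alpha> f = amalgam_norm M d q p \<alpha> g"
proof -
  have loc: "local_norm M d q p \<alpha> r f y = local_norm M d q p \<alpha> r g y"
    if "y \<in> space M" "0 < r" for y r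
  proof -
    let ?B = "qball (space M) d y r"
    have B: "?B \<in> sets (completion M)" using qball_in_sets[OF that] by simp
    have "AE x in completion M. f x * indicator ?B x = g x * indicator ?B x"
      using AE_completion[OF eq] by eventually_elim simp
    then show ?thesis
      unfolding local_norm_def
      using f g B by (subst Lnorm_cong_AE[where g = "\<lambda>x. g x * indicator ?B x"]) auto
  qed
  then have "amalgam_norm_at M d q p \<alpha> r f = amalgam_norm_at M d q p \<alpha> r g" if "0 < r" for r
    using that by (auto simp: amalgam_norm_at_def cong: nn_integral_cong)
  then show ?thesis by (simp add: amalgam_norm_def)
qed

lemma (in homogeneous_type_space) on_class_amalgam_norm:
  assumes "f \<in> borel_measurable (completion M)"
  shows "on_class (amalgam_norm M d q p \<alpha>) (ae_class M f) = amalgam_norm M d q p \<alpha> f"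
  using assms by (intro on_class_ae_class amalgam_norm_cong_AE) (auto simp: ae_class_def)

text \<open>The ring fields \<open>mult\<close> and \<open>one\<close> of a module record play no role.\<close>

definition amalgam_space ::
  "'a measure \<Rightarrow> ('a \<Rightarrow> 'a \<Rightarrow> real) \<Rightarrow> ennreal \<Rightarrow> ennreal \<Rightarrow> ennreal \<Rightarrow> (complex, ('a \<Rightarrow> complex) set) module"
  where
  "amalgam_space M d q p \<alpha> =
    \<lparr>carrier = {F \<in> L0 M. on_class (amalgam_norm M d q p \<alpha>) F < \<infinity>},
     monoid.mult = undefined, one = undefined,
     ring.zero = ae_class M (\<lambda>x. 0), add = class_add M, smult = class_smult M\<rparr>"

definition complex_ring :: "complex ring" where
  "complex_ring =
    \<lparr>carrier = UNIV, monoid.mult = (*), one = 1, ring.zero = 0, add = (+)\<rparr>"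

definition complex_banach_space :: "(complex, 'v) module \<Rightarrow> ('v \<Rightarrow> real) \<Rightarrow> bool" where
  "complex_banach_space V N \<longleftrightarrow>
    Module.module complex_ring V \<and>
    (\<forall>v\<in>carrier V. 0 \<le> N v) \<and>
    (\<forall>v\<in>carrier V. N v = 0 \<longleftrightarrow> v = \<zero>\<^bsub>V\<^esub>) \<and>
    (\<forall>c. \<forall>v\<in>carrier V. N (c \<odot>\<^bsub>V\<^esub> v) = cmod c * N v) \<and>
    (\<forall>u\<in>carrier V. \<forall>v\<in>carrier V. N (u \<oplus>\<^bsub>V\<^esub> v) \<le> N u + N v) \<and>
    (\<forall>\<sigma>::nat \<Rightarrow> 'v. range \<sigma> \<subseteq> carrier V \<longrightarrow>
      (\<forall>\<epsilon>>0. \<exists>K. \<forall>m\<ge>K. \<forall>n\<ge>K. N (\<sigma> m \<ominus>\<^bsub>V\<^esub> \<sigma> n) < \<epsilon>) \<longrightarrow>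
      (\<exists>v\<in>carrier V. (\<lambda>n. N (\<sigma> n \<ominus>\<^bsub>V\<^esub> v)) \<longlonglongrightarrow> 0))"

end

theory Submission
  imports Defs
begin

text \<open>
  Write \<open>V(y, r)\<close> for the measure of \<open>B(y, r)\<close> and \<open>H\<^sub>q(y, r) = V(y, r)\<^bsup>1/\<alpha> - 1/q\<^esup> \<parallel>f \<chi>\<^bsub>B(y, r)\<^esub>\<parallel>\<^sub>q\<close>.
  The norm with outer exponent \<open>\<infinity>\<close> is the supremum of \<open>H\<^sub>q\<close>, and for finite \<open>p\<close> the norm at radius \<open>r\<close>
  is the \<open>L\<^sup>p\<close> norm of \<open>V\<^bsup>-1/p\<^esup> H\<^sub>q\<close>.

  Monotonicity in \<open>q\<close> holds pointwise with constant one, because power means on a ball increase with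
  the exponent (\<open>lp_norm_power_mean\<close>).  For monotonicity in \<open>p\<close>, doubling shows that \<open>H\<^sub>q(y, r)\<close> is at
  most a constant times \<open>H\<^sub>q(z, 2 \<kappa> r)\<close> for all \<open>z\<close> in \<open>B(y, r)\<close>; averaging over these \<open>z\<close> gives
  \<open>H\<^sub>q \<le> C \<parallel>f\<parallel>\<^bsub>q,p,\<alpha>\<^esub>\<close> (\<open>local_norm_le_amalgam_norm\<close>), and larger finite exponents follow by
  interpolation with this supremum bound (\<open>amalgam_norm_mono_p\<close>).

  Both monotonicities reduce the comparison with \<open>\<parallel>f\<parallel>\<^sub>\<alpha>\<close> to the case \<open>q = p = \<alpha>\<close>.  There the integrand
  is the mean of \<open>|f|\<^sup>\<alpha>\<close> over \<open>B(y, r)\<close>, and exchanging the order of integration bounds the integral of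
  these means by that of \<open>|f|\<^sup>\<alpha>\<close> (\<open>integral_ball_averages_le\<close>).

  The triangle inequality is Minkowski's inequality, applied inside each ball and then to the outer
  integral.  The outer application needs measurability in the centre of the ball, which comes from
  lower semicontinuity (\<open>borel_measurable_ball_integral\<close>).  Taking \<open>1\<close> for the inner and \<open>\<infinity>\<close> for the
  outer exponent, the two monotonicities embed the space continuously into \<open>L\<^sup>1\<close> of every ball.
  This makes the norm definite, and makes rapidly Cauchy sequences converge almost everywhere; Fatou's
  lemma then turns the pointwise limit into a limit in norm (\<open>amalgam_norm_complete\<close>).
\<close>

\<comment> \<open>The name \<open>top\<close> then refers to the greatest element of \<open>ennreal\<close>.\<close>
hide_const (open) Order.top

section \<open>Real powers of extended nonnegative numbers\<close>

lemma enn_powr_top [simp]: "enn_powr \<infinity> a = \<infinity>" "enn_powr top a = top"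
  by (auto simp: enn_powr_def)

lemma enn_powr_ennreal: "0 \<le> x \<Longrightarrow> enn_powr (ennreal x) a = ennreal (x powr a)"
  by (simp add: enn_powr_def)

lemma enn_powr_0 [simp]: "enn_powr 0 a = 0"
  by (simp add: enn_powr_def)

lemma enn_powr_1 [simp]: "enn_powr x 1 = x"
  by (cases x) (auto simp: enn_powr_ennreal)

lemma enn_powr_mono: "x \<le> y \<Longrightarrow> 0 \<le> a \<Longrightarrow> enn_powr x a \<le> enn_powr y a"
  by (cases x; cases y) (auto simp: enn_powr_ennreal top_unique intro!: ennreal_leI powr_mono2)

lemma enn_powr_powr: "enn_powr (enn_powr x a) b = enn_powr x (a * b)"
  by (cases x) (auto simp: enn_powr_ennreal powr_powr)

lemma enn_powr_powr_inverse [simp]: "a \<noteq> 0 \<Longrightarrow> enn_powr (enn_powr x a) (1 / a) = x"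
  "a \<noteq> 0 \<Longrightarrow> enn_powr (enn_powr x (1 / a)) a = x"
  by (simp_all add: enn_powr_powr)

lemma enn_powr_eq_0_iff [simp]: "enn_powr x a = 0 \<longleftrightarrow> x = 0"
  by (cases x) (auto simp: enn_powr_ennreal)

lemma enn_powr_eq_top_iff [simp]: "enn_powr x a = top \<longleftrightarrow> x = top"
  by (cases x) (auto simp: enn_powr_ennreal)

lemma enn_powr_mult: "enn_powr (x * y) a = enn_powr x a * enn_powr y a"
proof (cases "x = top \<or> y = top")
  case True
  then show ?thesis by (auto simp: ennreal_mult_top ennreal_top_mult ennreal_mult_eq_top_iff)
next
  case False
  then obtain u v where "x = ennreal u" "y = ennreal v" "0 \<le> u" "0 \<le> v"
    by (metis ennreal_cases)
  then show ?thesis by (simp add: enn_powr_ennreal powr_mult flip: ennreal_mult)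
qed

lemma enn_powr_add: "enn_powr x (a + b) = enn_powr x a * enn_powr x b"
  by (cases x) (auto simp: enn_powr_ennreal powr_add ennreal_mult)

lemma enn_powr_le_iff:
  assumes "0 < a"
  shows "enn_powr x (1 / a) \<le> y \<longleftrightarrow> x \<le> enn_powr y a"
  using enn_powr_mono[of "enn_powr x (1 / a)" y a] enn_powr_mono[of x "enn_powr y a" "1 / a"] assms
  by auto

lemma continuous_on_enn_powr:
  assumes "0 < a"
  shows "continuous_on UNIV (\<lambda>x. enn_powr x a)"
proof (rule continuous_onI_mono)
  have "range (\<lambda>x. enn_powr x a) = UNIV"
    using enn_powr_powr_inverse(2)[of a] assms by (metis less_irrefl surjI)
  then show "open (range (\<lambda>x. enn_powr x a))" by simp
qed (use assms in \<open>simp add: enn_powr_mono\<close>)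

lemma borel_measurable_enn_powr [measurable (raw)]:
  assumes "f \<in> borel_measurable M"
  shows "(\<lambda>x. enn_powr (f x) a) \<in> borel_measurable M"
  unfolding enn_powr_def using assms by measurable

lemma liminf_enn_powr:
  assumes "0 < a"
  shows "liminf (\<lambda>n. enn_powr (u n) a) = enn_powr (liminf u) a"
  using assms
  by (intro Liminf_compose_continuous_mono continuous_on_enn_powr)
     (auto intro!: monotone_onI enn_powr_mono)

text \<open>Convexity of the power function: the point \<open>(u + v) / (a + b)\<close> is the convex combination
  of \<open>u / a\<close> and \<open>v / b\<close> with weights \<open>a / (a + b)\<close> and \<open>b / (a + b)\<close>.  With \<open>a\<close> and \<open>b\<close>
  the \<open>L\<^sup>p\<close> norms of two functions, integrating this inequality gives Minkowski's inequality.\<close>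

lemma powr_add_le:
  fixes a b u v p :: real
  assumes "0 < a" "0 < b" "0 \<le> u" "0 \<le> v" "1 \<le> p"
  shows "(u + v) powr p \<le> (a + b) powr (p - 1) * (a powr (1 - p) * u powr p + b powr (1 - p) * v powr p)"
proof -
  have edge: "v powr p \<le> (a + b) powr (p - 1) * (b powr (1 - p) * v powr p)"
    if "0 < a" "0 < b" "0 \<le> v" for a b v :: real
  proof -
    have "1 \<le> ((a + b) / b) powr (p - 1)"
      using that \<open>1 \<le> p\<close> by (intro ge_one_powr_ge_zero) auto
    also have "\<dots> = (a + b) powr (p - 1) * b powr (1 - p)"
      using that by (simp add: powr_divide powr_minus_divide[of b "p - 1", simplified])
    finally show ?thesis
      using mult_right_mono[of 1 "(a + b) powr (p - 1) * b powr (1 - p)" "v powr p"]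
      by (simp add: mult.assoc)
  qed
  consider "u = 0" | "v = 0" | "0 < u" "0 < v" using assms by linarith
  then show ?thesis
  proof cases
    case 1
    then show ?thesis using edge[of a b v] assms by simp
  next
    case 2
    then show ?thesis using edge[of b a u] assms by (simp add: add.commute)
  next
    case 3
    define l where "l = b / (a + b)"
    have l: "0 \<le> l" "l \<le> 1" "1 - l = a / (a + b)" using assms by (auto simp: l_def field_simps)
    have "((1 - l) *\<^sub>R (u / a) + l *\<^sub>R (v / b)) powr p \<le> (1 - l) * (u / a) powr p + l * (v / b) powr p"
      using 3 assms l by (intro convex_onD[OF powr_convex]) auto
    moreover have "(1 - l) *\<^sub>R (u / a) + l *\<^sub>R (v / b) = (u + v) / (a + b)"
      using assms unfolding l(3) by (simp add: l_def add_divide_distrib)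
    ultimately have "(u + v) powr p / (a + b) powr p \<le>
        a / (a + b) * (u powr p / a powr p) + b / (a + b) * (v powr p / b powr p)"
      using 3 assms unfolding l(3) by (simp add: l_def powr_divide)
    then have "(u + v) powr p \<le> (a + b) powr p *
        (a / (a + b) * (u powr p / a powr p) + b / (a + b) * (v powr p / b powr p))"
      using assms by (simp add: divide_le_eq mult.commute)
    also have "\<dots> = (a + b) powr (p - 1) * (a powr (1 - p) * u powr p + b powr (1 - p) * v powr p)"
    proof -
      have "P * (a / S * (u' / a') + b / S * (v' / b')) = P / S * (a / a' * u' + b / b' * v')"
        for P S a' b' u' v' :: real
        by (simp add: distrib_left)
      then show ?thesis using assms by (simp add: powr_diff)
    qed
    finally show ?thesis .
  qed
qed

lemma enn_powr_add_le:
  assumes "0 < a" "0 < b" "1 \<le> p"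
  shows "enn_powr (u + v) p \<le> ennreal ((a + b) powr (p - 1) * a powr (1 - p)) * enn_powr u p +
    ennreal ((a + b) powr (p - 1) * b powr (1 - p)) * enn_powr v p"
proof (cases "u = top \<or> v = top")
  case True
  have "(a + b) powr (p - 1) * a powr (1 - p) > 0" "(a + b) powr (p - 1) * b powr (1 - p) > 0"
    using assms by auto
  then show ?thesis using True by (auto simp: ennreal_mult_top)
next
  case False
  then obtain x y where "u = ennreal x" "v = ennreal y" "0 \<le> x" "0 \<le> y"
    by (metis ennreal_cases)
  then show ?thesis
    using powr_add_le[of a b x y p] assms
    by (simp add: enn_powr_ennreal ennreal_leI algebra_simps flip: ennreal_plus ennreal_mult)
qed

text \<open>Young's inequality \<open>s\<^sup>\<theta> \<le> (1 - \<theta>) + \<theta> s\<close> at \<open>s = (u / c)\<^sup>t\<close> with \<open>\<theta> = r / t\<close>, which compares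
  two powers of the same number.\<close>

lemma enn_powr_young:
  assumes "0 < c" "0 < r" "r \<le> t"
  shows "enn_powr u r \<le> ennreal (c powr r * (1 - r / t)) + ennreal (c powr (r - t) * (r / t)) * enn_powr u t"
proof -
  consider "u = top" | "u = 0" | x where "u = ennreal x" "0 < x"
    by (cases u) (auto simp: less_le)
  then show ?thesis
  proof cases
    case 1
    then show ?thesis using assms by (auto simp: ennreal_mult_top)
  next
    case 2
    then show ?thesis by simp
  next
    case 3
    define s where "s = (x / c) powr t"
    have "s powr (r / t) * 1 powr (1 - r / t) \<le> r / t * s + (1 - r / t) * 1"
      using 3 assms by (intro Youngs_inequality_0) (auto simp: s_def)
    then have "(x / c) powr r \<le> r / t * (x / c) powr t + (1 - r / t)"
      using assms by (simp add: s_def powr_powr)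
    then have "c powr r * (x / c) powr r \<le> c powr r * (r / t * (x / c) powr t + (1 - r / t))"
      by (intro mult_left_mono) auto
    moreover have "c powr r * (x / c) powr r = x powr r"
      using 3 assms by (simp add: powr_divide)
    moreover have "c powr r * (r / t * (x / c) powr t + (1 - r / t)) =
        c powr r * (1 - r / t) + c powr (r - t) * (r / t) * x powr t"
      using 3 assms by (simp add: powr_divide powr_diff field_simps)
    moreover have "0 \<le> c powr r * (1 - r / t)" "0 \<le> c powr (r - t) * (r / t)"
      using assms by auto
    moreover have "0 \<le> c powr (r - t) * (r / t) * x powr t"
      using assms by auto
    ultimately have "ennreal (x powr r) \<le>
        ennreal (c powr r * (1 - r / t)) + ennreal (c powr (r - t) * (r / t) * x powr t)"
      by (metis ennreal_leI ennreal_plus)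
    then show ?thesis
      using 3 \<open>0 \<le> c powr (r - t) * (r / t)\<close>
      by (simp add: enn_powr_ennreal flip: ennreal_mult)
  qed
qed

section \<open>Lebesgue norms of extended nonnegative functions\<close>

text \<open>The local norms are functions of the centre of the ball that may take the value \<open>\<infinity>\<close>, so the outer
  norm requires Lebesgue norms of functions with values in \<open>[0, \<infinity>]\<close>.\<close>

definition lp_norm :: "'a measure \<Rightarrow> ennreal \<Rightarrow> ('a \<Rightarrow> ennreal) \<Rightarrow> ennreal" where
  "lp_norm N s u =
    (if s = \<infinity> then esssup N u else enn_powr (\<integral>\<^sup>+x. enn_powr (u x) (enn2real s) \<partial>N) (recip s))"

lemma Lnorm_eq_lp_norm: "Lnorm N s f = lp_norm N s (\<lambda>x. ennreal (cmod (f x)))"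
  by (simp add: Lnorm_def lp_norm_def enn_powr_ennreal)

lemma exponent_cases:
  fixes s :: ennreal
  assumes "1 \<le> s"
  obtains "s = \<infinity>" "recip s = 0"
  | t where "1 \<le> t" "s = ennreal t" "enn2real s = t" "recip s = 1 / t" "s \<noteq> \<infinity>"
proof (cases s)
  case (real t)
  then have "1 \<le> t" using assms by (simp flip: ennreal_1)
  then show ?thesis using real by (intro that(2)[of t]) (auto simp: recip_def inverse_ennreal divide_inverse)
qed (use that(1) in \<open>simp add: recip_def\<close>)

lemma lp_norm_ennreal:
  "1 \<le> t \<Longrightarrow> lp_norm N (ennreal t) u = enn_powr (\<integral>\<^sup>+x. enn_powr (u x) t \<partial>N) (1 / t)"
  by (simp add: lp_norm_def recip_def inverse_ennreal divide_inverse)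

lemma lp_norm_top: "lp_norm N top u = esssup N u"
  by (simp add: lp_norm_def)

lemma lp_norm_mono_AE:
  assumes "1 \<le> s" "u \<in> borel_measurable N" "AE x in N. u x \<le> v x"
  shows "lp_norm N s u \<le> lp_norm N s v"
  using assms(1)
proof (cases rule: exponent_cases)
  case 1
  then show ?thesis using assms by (simp add: lp_norm_top esssup_AE_mono)
next
  case (2 t)
  have "AE x in N. enn_powr (u x) t \<le> enn_powr (v x) t"
    using assms(3) by eventually_elim (use 2 in \<open>simp add: enn_powr_mono\<close>)
  then show ?thesis using 2 by (simp add: lp_norm_ennreal enn_powr_mono nn_integral_mono_AE)
qed

lemma lp_norm_cmult_le:
  assumes "1 \<le> s" "u \<in> borel_measurable N"
  shows "lp_norm N s (\<lambda>x. c * u x) \<le> c * lp_norm N s u"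
  using assms(1)
proof (cases rule: exponent_cases)
  case 1
  have "AE x in N. c * u x \<le> c * esssup N u"
    using esssup_AE[of u N] by eventually_elim (simp add: mult_left_mono)
  then show ?thesis using 1 assms by (auto simp: lp_norm_top)
next
  case (2 t)
  then show ?thesis using assms
    by (simp add: lp_norm_ennreal enn_powr_mult nn_integral_cmult)
qed

lemma lp_norm_zero: "1 \<le> s \<Longrightarrow> lp_norm N s (\<lambda>x. 0) = 0"
  using lp_norm_cmult_le[of s "\<lambda>x. 0" N 0] by simp

lemma lp_norm_cong_AE:
  assumes "1 \<le> s" "u \<in> borel_measurable N" "v \<in> borel_measurable N" "AE x in N. u x = v x"
  shows "lp_norm N s u = lp_norm N s v"
  using assms by (intro antisym lp_norm_mono_AE) (auto elim: eventually_mono)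

text \<open>Minkowski's inequality: the convexity estimate \<open>enn_powr_add_le\<close> is integrated with the norms of
  the two functions as its parameters.  Norms \<open>0\<close> and \<open>\<infinity>\<close> are excluded there and treated apart.\<close>

lemma lp_norm_triangle:
  assumes s: "1 \<le> s" and [measurable]: "u \<in> borel_measurable N" "v \<in> borel_measurable N"
  shows "lp_norm N s (\<lambda>x. u x + v x) \<le> lp_norm N s u + lp_norm N s v"
  using s
proof (cases rule: exponent_cases)
  case 1
  have "AE x in N. u x + v x \<le> esssup N u + esssup N v"
    using esssup_AE[of u N] esssup_AE[of v N] by eventually_elim (simp add: add_mono)
  then show ?thesis using 1 by (auto simp: lp_norm_top)
next
  case (2 p)
  have zero: "AE x in N. w x = 0" if "lp_norm N s w = 0" "w \<in> borel_measurable N" for w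
    using that 2 by (simp add: lp_norm_ennreal nn_integral_0_iff_AE)
  consider "lp_norm N s u = top \<or> lp_norm N s v = top" | "lp_norm N s u = 0" | "lp_norm N s v = 0"
    | a b where "0 < a" "0 < b" "lp_norm N s u = ennreal a" "lp_norm N s v = ennreal b"
    by (metis ennreal_cases less_le ennreal_0)
  then show ?thesis
  proof cases
    case 1
    then show ?thesis by auto
  next
    case 2
    then have "AE x in N. u x + v x = v x" using zero[of u] by (auto elim: eventually_mono)
    then show ?thesis using 2 s by (subst lp_norm_cong_AE[where v = v]) auto
  next
    case 3
    then have "AE x in N. u x + v x = u x" using zero[of v] by (auto elim: eventually_mono)
    then show ?thesis using 3 s by (subst lp_norm_cong_AE[where v = u]) auto
  next
    case (4 a b)
    have int: "(\<integral>\<^sup>+x. enn_powr (w x) p \<partial>N) = ennreal (c powr p)"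
      if "lp_norm N s w = ennreal c" "0 < c" for w c
    proof -
      have "enn_powr (lp_norm N s w) p = (\<integral>\<^sup>+x. enn_powr (w x) p \<partial>N)"
        using \<open>1 \<le> p\<close> \<open>s = ennreal p\<close> by (simp add: lp_norm_ennreal)
      then show ?thesis using that by (simp add: enn_powr_ennreal)
    qed
    have "(\<integral>\<^sup>+x. enn_powr (u x + v x) p \<partial>N) \<le>
        (\<integral>\<^sup>+x. ennreal ((a + b) powr (p - 1) * a powr (1 - p)) * enn_powr (u x) p +
          ennreal ((a + b) powr (p - 1) * b powr (1 - p)) * enn_powr (v x) p \<partial>N)"
      using 4 2 by (intro nn_integral_mono enn_powr_add_le) auto
    also have "\<dots> = ennreal ((a + b) powr (p - 1) * a powr (1 - p)) * ennreal (a powr p) +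
          ennreal ((a + b) powr (p - 1) * b powr (1 - p)) * ennreal (b powr p)"
      using int[of u a] int[of v b] 4 by (simp add: nn_integral_add nn_integral_cmult)
    also have "\<dots> = ennreal ((a + b) powr (p - 1) * (a powr (1 - p) * a powr p + b powr (1 - p) * b powr p))"
      by (simp add: algebra_simps flip: ennreal_mult ennreal_plus)
    also have "(a + b) powr (p - 1) * (a powr (1 - p) * a powr p + b powr (1 - p) * b powr p) = (a + b) powr p"
      using 4 by (simp add: powr_diff flip: powr_add)
    finally have "(\<integral>\<^sup>+x. enn_powr (u x + v x) p \<partial>N) \<le> enn_powr (ennreal a + ennreal b) p"
      using 4 by (simp add: enn_powr_ennreal flip: ennreal_plus)
    then show ?thesis using 4 2 by (simp add: lp_norm_ennreal enn_powr_le_iff)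
  qed
qed

lemma lp_norm_fatou:
  fixes u :: "nat \<Rightarrow> 'a \<Rightarrow> ennreal"
  assumes s: "1 \<le> s" and [measurable]: "\<And>n. u n \<in> borel_measurable N" "v \<in> borel_measurable N"
    and v: "AE x in N. v x \<le> liminf (\<lambda>n. u n x)"
  shows "lp_norm N s v \<le> liminf (\<lambda>n. lp_norm N s (u n))"
  using s
proof (cases rule: exponent_cases)
  case 1
  have "AE x in N. \<forall>n. u n x \<le> esssup N (u n)" by (simp add: AE_all_countable esssup_AE)
  then have "AE x in N. v x \<le> liminf (\<lambda>n. esssup N (u n))"
    using v
  proof eventually_elim
    fix x
    assume "\<forall>n. u n x \<le> esssup N (u n)" "v x \<le> liminf (\<lambda>n. u n x)"
    then show "v x \<le> liminf (\<lambda>n. esssup N (u n))"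
      using Liminf_mono[of "\<lambda>n. u n x" "\<lambda>n. esssup N (u n)" sequentially] by auto
  qed
  then show ?thesis using 1 by (auto simp: lp_norm_top)
next
  case (2 t)
  have "AE x in N. enn_powr (v x) t \<le> liminf (\<lambda>n. enn_powr (u n x) t)"
    using v by eventually_elim (use 2 in \<open>simp add: liminf_enn_powr enn_powr_mono\<close>)
  then have "(\<integral>\<^sup>+x. enn_powr (v x) t \<partial>N) \<le> (\<integral>\<^sup>+x. liminf (\<lambda>n. enn_powr (u n x) t) \<partial>N)"
    by (rule nn_integral_mono_AE)
  also have "\<dots> \<le> liminf (\<lambda>n. \<integral>\<^sup>+x. enn_powr (u n x) t \<partial>N)"
    by (rule nn_integral_liminf) simp
  finally show ?thesis using 2 by (simp add: lp_norm_ennreal liminf_enn_powr enn_powr_mono)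
qed

text \<open>Monotonicity of power means.  The proof integrates Young's inequality over \<open>B\<close> after scaling \<open>u\<close>
  so that its mean of order \<open>s'\<close> is one.\<close>

lemma lp_norm_power_mean:
  assumes s: "1 \<le> s" "s \<le> s'"
    and B [measurable]: "B \<in> sets N" and m: "emeasure N B = ennreal m" "0 < m"
    and [measurable]: "u \<in> borel_measurable N" and u: "\<And>x. x \<notin> B \<Longrightarrow> u x = 0"
  shows "lp_norm N s u \<le> ennreal (m powr (recip s - recip s')) * lp_norm N s' u"
proof -
  have "1 \<le> s'" using s by simp
  have pos: "ennreal (m powr e) \<noteq> 0" for e using m by simp
  show ?thesis
    using s(1)
  proof (cases rule: exponent_cases)
    case 1
    then have "s' = s" using s by (simp add: top_unique)
    then show ?thesis using m by simp
  next
    case (2 r)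
    note r = this
    show ?thesis
      using \<open>1 \<le> s'\<close>
    proof (cases rule: exponent_cases)
      case 1
      define c where "c = esssup N u"
      have "AE x in N. enn_powr (u x) r \<le> enn_powr c r * indicator B x"
        using esssup_AE[of u N]
        by eventually_elim (use r u in \<open>auto simp: c_def enn_powr_mono split: split_indicator\<close>)
      then have "(\<integral>\<^sup>+x. enn_powr (u x) r \<partial>N) \<le> (\<integral>\<^sup>+x. enn_powr c r * indicator B x \<partial>N)"
        by (rule nn_integral_mono_AE)
      also have "\<dots> = enn_powr c r * ennreal m" by (simp add: nn_integral_cmult_indicator m)
      also have "\<dots> = enn_powr (ennreal (m powr (1 / r)) * c) r"
        using m r by (simp add: enn_powr_mult enn_powr_ennreal powr_powr mult.commute)
      finally show ?thesis
        using r 1 by (simp add: lp_norm_ennreal enn_powr_le_iff lp_norm_top c_def)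
    next
      case (2 t)
      have rt: "r \<le> t" using r 2 s by (simp add: ennreal_le_iff)
      consider "lp_norm N s' u = top" | "lp_norm N s' u = 0" | b where "lp_norm N s' u = ennreal b" "0 < b"
        by (metis ennreal_cases less_le ennreal_0)
      then show ?thesis
      proof cases
        case 1
        then show ?thesis using pos by (simp add: ennreal_mult_top)
      next
        case zero: 2
        then have "AE x in N. u x = 0" using 2 by (simp add: lp_norm_ennreal nn_integral_0_iff_AE)
        then have "lp_norm N s u = lp_norm N s (\<lambda>x. 0)" using s by (intro lp_norm_cong_AE) auto
        then show ?thesis using s by (simp add: lp_norm_zero)
      next
        case (3 b)
        \<comment> \<open>The scale at which \<open>u\<close> has normalised \<open>L\<^sup>t\<close> norm one.\<close>
        define c where "c = b * m powr (- 1 / t)"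
        have c: "0 < c" using 3 m by (simp add: c_def)
        have ct: "c powr t = b powr t / m"
          using 3 m 2 by (simp add: c_def powr_mult powr_divide powr_powr powr_minus_divide)
        have int: "(\<integral>\<^sup>+x. enn_powr (u x) t \<partial>N) = ennreal (b powr t)"
        proof -
          have "enn_powr (lp_norm N s' u) t = (\<integral>\<^sup>+x. enn_powr (u x) t \<partial>N)"
            using 2 by (simp add: lp_norm_ennreal)
          then show ?thesis using 3 by (simp add: enn_powr_ennreal)
        qed
        have "(\<integral>\<^sup>+x. enn_powr (u x) r \<partial>N) \<le>
            (\<integral>\<^sup>+x. ennreal (c powr r * (1 - r / t)) * indicator B x +
              ennreal (c powr (r - t) * (r / t)) * enn_powr (u x) t \<partial>N)"
        proof (intro nn_integral_mono)
          fix x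
          show "enn_powr (u x) r \<le> ennreal (c powr r * (1 - r / t)) * indicator B x +
              ennreal (c powr (r - t) * (r / t)) * enn_powr (u x) t"
            using enn_powr_young[of c r t "u x"] c r rt u[of x] by (cases "x \<in> B") auto
        qed
        also have "\<dots> = ennreal (c powr r * (1 - r / t)) * ennreal m +
            ennreal (c powr (r - t) * (r / t)) * ennreal (b powr t)"
          by (simp add: nn_integral_add nn_integral_cmult nn_integral_cmult_indicator m int)
        also have "\<dots> = ennreal (c powr r * (1 - r / t) * m + c powr (r - t) * (r / t) * b powr t)"
          using r 2 rt m by (simp flip: ennreal_mult ennreal_plus)
        also have "c powr r * (1 - r / t) * m + c powr (r - t) * (r / t) * b powr t = c powr r * m"
          using r 2 3 m c by (simp add: powr_diff ct field_simps)
        also have "c powr r * m = (m powr (1 / r - 1 / t) * b) powr r"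
        proof -
          have "(1 / r - 1 / t) * r = 1 + - r / t" using r by (simp add: field_simps)
          then have "(m powr (1 / r - 1 / t)) powr r = m * m powr (- r / t)"
            using m by (simp only: powr_powr powr_add) simp
          moreover have "(m powr (- 1 / t)) powr r = m powr (- r / t)"
            by (simp add: powr_powr)
          ultimately show ?thesis
            by (simp add: c_def powr_mult)
        qed
        also have "ennreal \<dots> = enn_powr (ennreal (m powr (1 / r - 1 / t)) * ennreal b) r"
          using 3 by (simp add: enn_powr_ennreal flip: ennreal_mult)
        finally show ?thesis using r 2 3 by (simp add: lp_norm_ennreal enn_powr_le_iff)
      qed
    qed
  qed
qed

section \<open>Balls in spaces of homogeneous type\<close>

context homogeneous_type_space
begin

abbreviation ball_at :: "'a \<Rightarrow> real \<Rightarrow> 'a set" where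
  "ball_at y r \<equiv> qball (space M) d y r"

abbreviation vol :: "'a \<Rightarrow> real \<Rightarrow> real" where
  "vol y r \<equiv> measure M (ball_at y r)"

definition quasi_const :: real where
  "quasi_const = (SOME \<kappa>. 1 \<le> \<kappa> \<and>
    (\<forall>x\<in>space M. \<forall>y\<in>space M. \<forall>z\<in>space M. d x y \<le> \<kappa> * (d x z + d z y)))"

lemma quasi_const_ge_1: "1 \<le> quasi_const"
  and quasi_const_triangle:
    "\<lbrakk>x \<in> space M; y \<in> space M; z \<in> space M\<rbrakk> \<Longrightarrow> d x y \<le> quasi_const * (d x z + d z y)"
  using someI_ex[of "\<lambda>\<kappa>. 1 \<le> \<kappa> \<and>
    (\<forall>x\<in>space M. \<forall>y\<in>space M. \<forall>z\<in>space M. d x y \<le> \<kappa> * (d x z + d z y))"] quasi_triangle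
  unfolding quasi_const_def by auto

lemma quasi_const_triangle_less:
  assumes "x \<in> space M" "y \<in> space M" "z \<in> space M" "d x z < s" "d z y < t"
  shows "d x y < quasi_const * (s + t)"
proof -
  have "quasi_const * (d x z + d z y) < quasi_const * (s + t)"
    using assms quasi_const_ge_1 by (intro mult_strict_left_mono) auto
  then show ?thesis using quasi_const_triangle[OF assms(1-3)] by linarith
qed

lemma mem_ball_at: "x \<in> ball_at y r \<longleftrightarrow> x \<in> space M \<and> d y x < r"
  by (simp add: qball_def)

lemma ball_at_sym: "x \<in> space M \<Longrightarrow> y \<in> space M \<Longrightarrow> x \<in> ball_at y r \<longleftrightarrow> y \<in> ball_at x r"
  by (simp add: mem_ball_at commute)

lemma ball_at_mono: "r \<le> s \<Longrightarrow> ball_at y r \<subseteq> ball_at y s"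
  by (auto simp: mem_ball_at)

lemma centre_in_ball_at: "y \<in> space M \<Longrightarrow> 0 < r \<Longrightarrow> y \<in> ball_at y r"
  using zero_iff[of y y] by (simp add: mem_ball_at)

lemma emeasure_ball_at:
  assumes "y \<in> space M" "0 < r"
  shows "emeasure M (ball_at y r) = ennreal (vol y r)" "0 < vol y r"
proof -
  obtain C where C: "0 < emeasure M (ball_at x (2 * r))"
      "emeasure M (ball_at x (2 * r)) \<le> ennreal C * emeasure M (ball_at x r)"
      "ennreal C * emeasure M (ball_at x r) < \<infinity>" if "x \<in> space M" "0 < r" for x r
    using doubling by blast
  have pos: "0 < emeasure M (ball_at y r)" using C(1)[of y "r / 2"] assms by simp
  have "ennreal C \<noteq> 0" using C(1,2)[OF assms] by auto
  then have "emeasure M (ball_at y r) < \<infinity>" using C(3)[OF assms]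
    by (auto simp: ennreal_mult_less_top less_top)
  then show "emeasure M (ball_at y r) = ennreal (vol y r)"
    by (simp add: emeasure_eq_ennreal_measure)
  then show "0 < vol y r" using pos by simp
qed

lemma vol_mono:
  assumes "x \<in> space M" "y \<in> space M" "0 < r" "0 < s" "ball_at x r \<subseteq> ball_at y s"
  shows "vol x r \<le> vol y s"
proof (rule measure_mono_fmeasurable[OF assms(5)])
  show "ball_at x r \<in> sets M" using assms by (intro qball_in_sets)
  show "ball_at y s \<in> fmeasurable M"
    using assms qball_in_sets[of y s] emeasure_ball_at(1)[of y s] by (intro fmeasurableI) auto
qed

lemma vol_doubling: "\<exists>C\<ge>1. \<forall>x\<in>space M. \<forall>r>0. vol x (2 * r) \<le> C * vol x r"
proof -
  obtain C where C: "\<And>x r. x \<in> space M \<Longrightarrow> 0 < r \<Longrightarrow>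
      emeasure M (ball_at x (2 * r)) \<le> ennreal C * emeasure M (ball_at x r)"
    using doubling by blast
  have "vol x (2 * r) \<le> max 1 C * vol x r" if "x \<in> space M" "0 < r" for x r
  proof -
    have "ennreal (vol x (2 * r)) \<le> ennreal C * ennreal (vol x r)"
      using C[OF that] that by (simp add: emeasure_ball_at)
    also have "\<dots> \<le> ennreal (max 1 C) * ennreal (vol x r)"
      by (intro mult_right_mono ennreal_leI) auto
    finally show ?thesis by (simp add: ennreal_le_iff flip: ennreal_mult)
  qed
  then show ?thesis by (intro exI[of _ "max 1 C"]) auto
qed

lemma vol_dilate:
  assumes "0 < l"
  shows "\<exists>C\<ge>1. \<forall>x\<in>space M. \<forall>r>0. vol x (l * r) \<le> C * vol x r"
proof -
  obtain C where C: "1 \<le> C" "\<And>x r. x \<in> space M \<Longrightarrow> 0 < r \<Longrightarrow> vol x (2 * r) \<le> C * vol x r"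
    using vol_doubling by blast
  obtain n where "l < 2 ^ n"
    using real_arch_pow[of 2 l] by auto
  then have n: "l \<le> 2 ^ n" by simp
  have pow: "vol x (2 ^ n * r) \<le> C ^ n * vol x r" if "x \<in> space M" "0 < r" for x r and n :: nat
  proof (induction n)
    case (Suc n)
    have "vol x (2 ^ Suc n * r) \<le> C * vol x (2 ^ n * r)"
      using C(2)[OF that(1), of "2 ^ n * r"] that by (simp add: mult.assoc)
    also have "\<dots> \<le> C * (C ^ n * vol x r)" using Suc C by (intro mult_left_mono) auto
    finally show ?case by (simp add: mult.assoc)
  qed simp
  have "vol x (l * r) \<le> C ^ n * vol x r" if "x \<in> space M" "0 < r" for x r
  proof -
    have "l * r \<le> 2 ^ n * r" using n that by (intro mult_right_mono) auto
    then have "vol x (l * r) \<le> vol x (2 ^ n * r)"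
      using that assms by (intro vol_mono ball_at_mono) auto
    then show ?thesis using pow[OF that, of n] by simp
  qed
  moreover have "1 \<le> C ^ n" using C by (simp add: one_le_power)
  ultimately show ?thesis by blast
qed

text \<open>By the quasi-triangle inequality \<open>B(x, l r)\<close> is contained in the ball about \<open>y\<close> of radius
  \<open>2 \<kappa> l r\<close>, to which doubling applies.\<close>

lemma vol_comparable:
  assumes "0 < l"
  shows "\<exists>D\<ge>1. \<forall>x\<in>space M. \<forall>y\<in>space M. \<forall>r>0. d x y < l * r \<longrightarrow> vol x (l * r) \<le> D * vol y r"
proof -
  let ?k = "quasi_const * (l + l)"
  obtain D where D: "1 \<le> D" "\<And>x r. x \<in> space M \<Longrightarrow> 0 < r \<Longrightarrow> vol x (?k * r) \<le> D * vol x r"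
    using vol_dilate[of ?k] assms quasi_const_ge_1 by auto
  have "vol x (l * r) \<le> D * vol y r" if xy: "x \<in> space M" "y \<in> space M" "0 < r" "d x y < l * r" for x y r
  proof -
    have k: "0 < ?k * r" using assms quasi_const_ge_1 xy by auto
    have "ball_at x (l * r) \<subseteq> ball_at y (?k * r)"
    proof
      fix z assume "z \<in> ball_at x (l * r)"
      then have z: "z \<in> space M" "d x z < l * r" by (auto simp: mem_ball_at)
      have "d y z < quasi_const * (l * r + l * r)"
        using quasi_const_triangle_less[of y z x "l * r" "l * r"] xy z commute[of x y] by simp
      also have "\<dots> = ?k * r" by (simp add: algebra_simps)
      finally show "z \<in> ball_at y (?k * r)" using z by (simp add: mem_ball_at)
    qed
    then have "vol x (l * r) \<le> vol y (?k * r)"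
      using xy k assms by (intro vol_mono) auto
    then show ?thesis using D(2)[OF xy(2,3)] by simp
  qed
  with D(1) show ?thesis by blast
qed

lemma space_eq_UN_balls:
  assumes "y \<in> space M"
  shows "space M = (\<Union>n::nat. ball_at y (real n + 1))"
proof -
  have "\<exists>n::nat. x \<in> ball_at y (real n + 1)" if "x \<in> space M" for x
  proof -
    obtain n :: nat where "d y x < real n" using reals_Archimedean2 by blast
    then have "d y x < real n + 1" by simp
    then show ?thesis using that by (auto simp: mem_ball_at)
  qed
  then show ?thesis by (auto simp: mem_ball_at)
qed

lemma space_nonempty: "space M \<noteq> {}"
  using infinite_measure by auto

lemma sigma_finite: "sigma_finite_measure M"
proof -
  obtain y where y: "y \<in> space M" using space_nonempty by blast
  show ?thesis
  proof (rule sigma_finite_measure.intro, intro exI conjI)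
    show "countable (range (\<lambda>n::nat. ball_at y (real n + 1)))" by simp
    show "range (\<lambda>n::nat. ball_at y (real n + 1)) \<subseteq> sets M"
      using y by (auto intro!: qball_in_sets)
    show "\<Union> (range (\<lambda>n::nat. ball_at y (real n + 1))) = space M"
      using space_eq_UN_balls[OF y] by simp
    show "\<forall>a\<in>range (\<lambda>n::nat. ball_at y (real n + 1)). emeasure M a \<noteq> \<infinity>"
      using y by (auto simp: emeasure_ball_at)
  qed
qed

lemma dense_sequence:
  obtains D where "countable D" "D \<subseteq> space M"
    "\<And>y r. y \<in> space M \<Longrightarrow> 0 < r \<Longrightarrow> D \<inter> ball_at y r \<noteq> {}"
proof -
  have top: "topspace (qtopology (space M) d) = space M"
  proof -
    have "openin (qtopology (space M) d) (space M)"
      by (auto simp: openin_qtopology qball_def intro!: exI[of _ "1::real"])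
    then show ?thesis
      by (metis openin_qtopology openin_subset openin_topspace subset_antisym)
  qed
  obtain D where D: "countable D" "D \<subseteq> space M" "qtopology (space M) d closure_of D = space M"
    using separable unfolding separable_space_def top by blast
  have "D \<inter> ball_at y r \<noteq> {}" if "y \<in> space M" "0 < r" for y r
  proof -
    have "y \<in> qtopology (space M) d closure_of D" using D(3) that by simp
    then show ?thesis
      using openin_qball[OF that] centre_in_ball_at[OF that] unfolding in_closure_of by blast
  qed
  with D that show ?thesis by blast
qed

text \<open>If \<open>y\<^sub>n\<close> tends to \<open>y\<close>, then every point of the open ball \<open>B(y, r)\<close> lies in \<open>B(y\<^sub>n, r)\<close> for large
  \<open>n\<close>, because \<open>y\<close> belongs to the open ball of radius \<open>r\<close> about that point.  By Fatou's lemma the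
  integral of a nonnegative function over \<open>B(y, r)\<close> is therefore lower semicontinuous in \<open>y\<close>.\<close>

lemma borel_measurable_ball_integral:
  assumes r: "0 < r" and g [measurable]: "g \<in> borel_measurable (completion M)"
  shows "(\<lambda>y. \<integral>\<^sup>+x. g x * indicator (ball_at y r) x \<partial>completion M) \<in> borel_measurable M"
proof (rule borel_measurableI_greater)
  fix a
  let ?F = "\<lambda>y. \<integral>\<^sup>+x. g x * indicator (ball_at y r) x \<partial>completion M"
  let ?S = "{y \<in> space M. a < ?F y}"
  have "openin (qtopology (space M) d) ?S"
    unfolding openin_qtopology
  proof (intro conjI ballI)
    show "?S \<subseteq> space M" by auto
    fix y assume y: "y \<in> ?S"
    show "\<exists>\<delta>>0. ball_at y \<delta> \<subseteq> ?S"
    proof (rule ccontr)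
      assume "\<not> ?thesis"
      then have "\<not> ball_at y \<delta> \<subseteq> ?S" if "0 < \<delta>" for \<delta> using that by blast
      from this[of "1 / real (Suc _)"]
      have "\<forall>n. \<exists>z. z \<in> ball_at y (1 / real (Suc n)) \<and> z \<notin> ?S"
        unfolding subset_iff by fastforce
      from choice[OF this] obtain z
        where z: "\<And>n. z n \<in> ball_at y (1 / real (Suc n))" "\<And>n. z n \<notin> ?S"
        by blast
      have zM: "z n \<in> space M" for n using z(1)[of n] by (simp add: mem_ball_at)
      have Fz: "?F (z n) \<le> a" for n using z(2)[of n] zM[of n] by simp
      have [measurable]: "ball_at (z n) r \<in> sets (completion M)" for n
        using qball_in_sets[OF zM r] by simp
      have "?F y \<le> (\<integral>\<^sup>+x. liminf (\<lambda>n. g x * indicator (ball_at (z n) r) x) \<partial>completion M)"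
      proof (rule nn_integral_mono)
        fix x assume "x \<in> space (completion M)"
        then have x: "x \<in> space M" by simp
        show "g x * indicator (ball_at y r) x \<le> liminf (\<lambda>n. g x * indicator (ball_at (z n) r) x)"
        proof (cases "x \<in> ball_at y r")
          case True
          then have "y \<in> ball_at x r" using x y ball_at_sym by blast
          then obtain \<delta> where \<delta>: "0 < \<delta>" "ball_at y \<delta> \<subseteq> ball_at x r"
            using openin_qball[OF x r] unfolding openin_qtopology by blast
          obtain N where N: "1 / real (Suc N) < \<delta>" using \<delta>(1) nat_approx_posE by blast
          have "x \<in> ball_at (z n) r" if "N \<le> n" for n
          proof -
            have "1 / real (Suc n) \<le> 1 / real (Suc N)" using that by (simp add: frac_le)
            then have "z n \<in> ball_at y \<delta>"
              using z(1)[of n] ball_at_mono[of "1 / real (Suc n)" \<delta> y] N by auto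
            then show ?thesis using \<delta>(2) ball_at_sym[OF x zM] by blast
          qed
          then have "\<forall>\<^sub>F n in sequentially. g x \<le> g x * indicator (ball_at (z n) r) x"
            by (auto simp: eventually_sequentially intro!: exI[of _ N])
          then have "g x \<le> liminf (\<lambda>n. g x * indicator (ball_at (z n) r) x)"
            by (rule Liminf_bounded)
          with True show ?thesis by simp
        qed simp
      qed
      also have "\<dots> \<le> liminf (\<lambda>n. ?F (z n))" by (rule nn_integral_liminf) simp
      also have "\<dots> \<le> liminf (\<lambda>n. a)" using Fz by (intro Liminf_mono) simp
      also have "\<dots> = a" by (simp add: Liminf_const)
      finally have "?F y \<le> a" .
      moreover have "a < ?F y" using y by blast
      ultimately show False by (meson leD)
    qed
  qed
  then show "?S \<in> sets M" unfolding sets_borel by (intro sigma_sets.Basic) simp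
qed

lemma borel_measurable_vol [measurable (raw)]:
  assumes "0 < r"
  shows "(\<lambda>y. vol y r) \<in> borel_measurable M"
proof -
  have "(\<lambda>y. enn2real (\<integral>\<^sup>+x. 1 * indicator (ball_at y r) x \<partial>completion M)) \<in> borel_measurable M"
    using borel_measurable_ball_integral[OF assms, of "\<lambda>x. 1"] by measurable
  also have "(\<lambda>y. enn2real (\<integral>\<^sup>+x. 1 * indicator (ball_at y r) x \<partial>completion M)) \<in> borel_measurable M
      \<longleftrightarrow> (\<lambda>y. vol y r) \<in> borel_measurable M"
    using qball_in_sets[OF _ assms]
    by (intro measurable_cong) (simp add: nn_integral_completion measure_def)
  finally show ?thesis .
qed

section \<open>Comparison of the amalgam norms\<close>

lemma local_norm_eq:
  "local_norm M d q p \<alpha> r f y = ennreal (vol y r powr (recip \<alpha> - recip p - recip q)) *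
    lp_norm (completion M) q (\<lambda>x. ennreal (cmod (f x)) * indicator (ball_at y r) x)"
proof -
  have "(\<lambda>x. ennreal (cmod (f x * indicator (ball_at y r) x))) =
      (\<lambda>x. ennreal (cmod (f x)) * indicator (ball_at y r) x)"
    by (auto split: split_indicator)
  then show ?thesis by (simp add: local_norm_def Lnorm_eq_lp_norm)
qed

lemma borel_measurable_cut [measurable (raw)]:
  assumes "f \<in> borel_measurable (completion M)" "y \<in> space M" "0 < r"
  shows "(\<lambda>x. ennreal (cmod (f x)) * indicator (ball_at y r) x) \<in> borel_measurable (completion M)"
proof -
  have [measurable]: "ball_at y r \<in> sets (completion M)" using qball_in_sets[OF assms(2,3)] by simp
  show ?thesis using assms(1) by measurable
qed

lemma recip_nonneg: "0 \<le> recip s"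
  by (simp add: recip_def)

lemma recip_antimono:
  assumes "1 \<le> s" "s \<le> t"
  shows "recip t \<le> recip s"
proof -
  have "1 \<le> t" using assms by simp
  then show ?thesis
  proof (cases rule: exponent_cases)
    case 1
    then show ?thesis by (simp add: recip_nonneg)
  next
    case t: (2 b)
    show ?thesis
      using assms(1)
    proof (cases rule: exponent_cases)
      case 1
      then show ?thesis using t assms by (simp add: top_unique)
    next
      case (2 a)
      then show ?thesis using t assms(2) by (simp add: ennreal_le_iff frac_le)
    qed
  qed
qed

lemma amalgam_norm_at_finite:
  "1 \<le> p \<Longrightarrow> p \<noteq> \<infinity> \<Longrightarrow> amalgam_norm_at M d q p \<alpha> r f = lp_norm M p (local_norm M d q p \<alpha> r f)"
  by (simp add: amalgam_norm_at_def lp_norm_def)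

text \<open>The outer integral occurs only for \<open>p < \<infinity>\<close>, and then \<open>q \<le> p\<close> makes \<open>q\<close> finite; in this
  case the local norm is a power of the measure of the ball times a power of an integral over it.\<close>

lemma local_norm_measurable:
  assumes q: "1 \<le> q" "q \<noteq> \<infinity>" and r: "0 < r" and f: "f \<in> borel_measurable (completion M)"
  shows "local_norm M d q p \<alpha> r f \<in> borel_measurable M"
  using q(1)
proof (cases rule: exponent_cases)
  case (2 t)
  have "(\<lambda>x. enn_powr (ennreal (cmod (f x)) * indicator (ball_at y r) x) t) =
      (\<lambda>x. enn_powr (ennreal (cmod (f x))) t * indicator (ball_at y r) x)" for y
    by (auto split: split_indicator)
  then have eq: "local_norm M d q p \<alpha> r f = (\<lambda>y. ennreal (vol y r powr (recip \<alpha> - recip p - recip q)) *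
      enn_powr (\<integral>\<^sup>+x. enn_powr (ennreal (cmod (f x))) t * indicator (ball_at y r) x \<partial>completion M) (1 / t))"
    using 2 by (simp add: local_norm_eq lp_norm_ennreal fun_eq_iff)
  have "(\<lambda>x. enn_powr (ennreal (cmod (f x))) t) \<in> borel_measurable (completion M)"
    using f by measurable
  note [measurable] = borel_measurable_ball_integral[OF r this] borel_measurable_vol[OF r]
  show ?thesis unfolding eq by measurable
qed (use q in simp)

lemma amalgam_norm_at_mono:
  assumes "1 \<le> p" "\<And>y. y \<in> space M \<Longrightarrow> local_norm M d q p \<alpha> r f y \<le> local_norm M d q' p \<alpha>' r' g y"
  shows "amalgam_norm_at M d q p \<alpha> r f \<le> amalgam_norm_at M d q' p \<alpha>' r' g"
proof (cases "p = \<infinity>")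
  case True
  have "(SUP y\<in>space M. local_norm M d q p \<alpha> r f y) \<le>
      (SUP y\<in>space M. local_norm M d q' p \<alpha>' r' g y)"
    using assms(2) by (intro SUP_mono) blast
  then show ?thesis using True by (simp add: amalgam_norm_at_def)
next
  case False
  then show ?thesis using assms
    by (auto simp: amalgam_norm_at_def recip_nonneg intro!: enn_powr_mono nn_integral_mono)
qed

lemma amalgam_norm_upper: "0 < r \<Longrightarrow> amalgam_norm_at M d q p \<alpha> r f \<le> amalgam_norm M d q p \<alpha> f"
  unfolding amalgam_norm_def by (rule SUP_upper) simp

lemma local_norm_mono_q:
  assumes "1 \<le> q" "q \<le> q'" "y \<in> space M" "0 < r" "f \<in> borel_measurable (completion M)"
  shows "local_norm M d q p \<alpha> r f y \<le> local_norm M d q' p \<alpha> r f y"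
proof -
  let ?u = "\<lambda>x. ennreal (cmod (f x)) * indicator (ball_at y r) x"
  have "lp_norm (completion M) q ?u \<le>
      ennreal (vol y r powr (recip q - recip q')) * lp_norm (completion M) q' ?u"
    using assms qball_in_sets[of y r] emeasure_ball_at[of y r]
    by (intro lp_norm_power_mean[where B = "ball_at y r"]) (auto intro: borel_measurable_cut)
  then have "local_norm M d q p \<alpha> r f y \<le> ennreal (vol y r powr (recip \<alpha> - recip p - recip q)) *
      (ennreal (vol y r powr (recip q - recip q')) * lp_norm (completion M) q' ?u)"
    unfolding local_norm_eq by (rule mult_left_mono) simp
  also have "\<dots> = local_norm M d q' p \<alpha> r f y"
  proof -
    have E: "recip \<alpha> - recip p - recip q + (recip q - recip q') = recip \<alpha> - recip p - recip q'" by simp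
    have "vol y r powr (recip \<alpha> - recip p - recip q) * vol y r powr (recip q - recip q')
        = vol y r powr (recip \<alpha> - recip p - recip q')"
      by (simp only: powr_add[symmetric] E)
    then show ?thesis by (simp add: local_norm_eq mult.assoc[symmetric] flip: ennreal_mult)
  qed
  finally show ?thesis .
qed

lemma amalgam_norm_mono_q:
  assumes "1 \<le> q" "q \<le> q'" "1 \<le> p" "f \<in> borel_measurable (completion M)"
  shows "amalgam_norm M d q p \<alpha> f \<le> amalgam_norm M d q' p \<alpha> f"
  unfolding amalgam_norm_def
proof (rule SUP_mono)
  fix r :: real assume "r \<in> {0<..}"
  then show "\<exists>s\<in>{0<..}. amalgam_norm_at M d q p \<alpha> r f \<le> amalgam_norm_at M d q' p \<alpha> s f"
    using assms by (intro bexI[of _ r] amalgam_norm_at_mono local_norm_mono_q) auto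
qed

text \<open>If \<open>z\<close> lies in \<open>B(y, r)\<close>, then \<open>B(y, r)\<close> is contained in \<open>B(z, 2 \<kappa> r)\<close> and the two balls have
  comparable measures.  Hence the quantity at \<open>(y, r)\<close> is dominated by the one at \<open>(z, 2 \<kappa> r)\<close>, and
  averaging the \<open>p\<close>-th powers over \<open>z\<close> in \<open>B(y, r)\<close> bounds it by the norm.\<close>

lemma local_norm_le_amalgam_norm:
  assumes "1 \<le> q" "q \<le> \<alpha>" "\<alpha> \<le> p"
  shows "\<exists>C>0. \<forall>f\<in>borel_measurable (completion M). \<forall>y\<in>space M. \<forall>r>0.
    local_norm M d q \<infinity> \<alpha> r f y \<le> ennreal C * amalgam_norm M d q p \<alpha> f"
proof -
  have "1 \<le> \<alpha>" "1 \<le> p" using assms by auto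
  show ?thesis
    using \<open>1 \<le> p\<close>
  proof (cases rule: exponent_cases)
    case 1
    have "local_norm M d q \<infinity> \<alpha> r f y \<le> ennreal 1 * amalgam_norm M d q p \<alpha> f"
      if "y \<in> space M" "0 < r" for f y r
    proof -
      have "local_norm M d q \<infinity> \<alpha> r f y \<le> amalgam_norm_at M d q p \<alpha> r f"
        using 1 that by (auto simp: amalgam_norm_at_def intro: SUP_upper)
      then show ?thesis using amalgam_norm_upper[OF that(2)] by (simp add: order_trans)
    qed
    then show ?thesis by (intro exI[of _ 1]) auto
  next
    case (2 t)
    let ?k = "2 * quasi_const"
    have k: "0 < ?k" "1 \<le> ?k" using quasi_const_ge_1 by auto
    obtain D where D: "1 \<le> D" "\<And>x y r. \<lbrakk>x \<in> space M; y \<in> space M; 0 < r; d x y < ?k * r\<rbrakk> \<Longrightarrow>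
        vol x (?k * r) \<le> D * vol y r"
      using vol_comparable[OF k(1)] by blast
    define e where "e = recip \<alpha> - recip p - recip q"
    have e: "e \<le> 0" using recip_antimono[OF assms(1,2)] recip_nonneg[of p] by (simp add: e_def)
    have e_inf: "recip \<alpha> - recip \<infinity> - recip q = e + 1 / t"
      using 2 by (simp add: e_def recip_def)
    have "local_norm M d q \<infinity> \<alpha> r f y \<le> ennreal (D powr - e) * amalgam_norm M d q p \<alpha> f"
      if f: "f \<in> borel_measurable (completion M)" and y: "y \<in> space M" and r: "0 < r" for f y r
    proof -
      let ?L = "\<lambda>z r. lp_norm (completion M) q (\<lambda>x. ennreal (cmod (f x)) * indicator (ball_at z r) x)"
      let ?c = "ennreal ((D * vol y r) powr e) * ?L y r"
      have lower: "?c \<le> local_norm M d q p \<alpha> (?k * r) f z" if z: "z \<in> ball_at y r" for z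
      proof -
        have zM: "z \<in> space M" and dz: "d y z < r" "d z y < r"
          using z y by (auto simp: mem_ball_at commute)
        have "ball_at y r \<subseteq> ball_at z (?k * r)"
        proof
          fix x assume "x \<in> ball_at y r"
          then show "x \<in> ball_at z (?k * r)"
            using quasi_const_triangle_less[of z x y r r] zM y dz by (auto simp: mem_ball_at)
        qed
        then have "?L y r \<le> ?L z (?k * r)"
          using assms f y r
          by (intro lp_norm_mono_AE borel_measurable_cut) (auto split: split_indicator)
        moreover have "(D * vol y r) powr e \<le> vol z (?k * r) powr e"
        proof (rule powr_mono2'[OF e])
          show "0 < vol z (?k * r)" using zM k r by (intro emeasure_ball_at) auto
          have "1 * r \<le> ?k * r" using k r by (intro mult_right_mono) auto
          then have "d z y < ?k * r" using dz by linarith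
          then show "vol z (?k * r) \<le> D * vol y r" using D(2) zM y r by blast
        qed
        ultimately show ?thesis
          unfolding local_norm_eq e_def[symmetric] by (intro mult_mono ennreal_leI) auto
      qed
      have "enn_powr (ennreal (D powr e) * local_norm M d q \<infinity> \<alpha> r f y) t =
          enn_powr (ennreal (vol y r powr (1 / t)) * ?c) t"
        using D(1) emeasure_ball_at(2)[OF y r]
        by (simp add: local_norm_eq e_inf[simplified] powr_mult powr_add mult_ac ennreal_mult)
      also have "\<dots> = enn_powr ?c t * ennreal (vol y r)"
        using 2 by (simp add: enn_powr_mult[of _ ?c] enn_powr_ennreal powr_powr mult.commute)
      also have "\<dots> = (\<integral>\<^sup>+z. enn_powr ?c t * indicator (ball_at y r) z \<partial>M)"
        using qball_in_sets[OF y r] by (simp add: nn_integral_cmult_indicator emeasure_ball_at y r)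
      also have "\<dots> \<le> (\<integral>\<^sup>+z. enn_powr (local_norm M d q p \<alpha> (?k * r) f z) t \<partial>M)"
        using 2 lower by (intro nn_integral_mono) (auto simp: enn_powr_mono split: split_indicator)
      also have "\<dots> = enn_powr (amalgam_norm_at M d q p \<alpha> (?k * r) f) t"
        using 2 by (simp add: amalgam_norm_at_def)
      also have "\<dots> \<le> enn_powr (amalgam_norm M d q p \<alpha> f) t"
        using 2 k r by (intro enn_powr_mono amalgam_norm_upper) auto
      finally have "ennreal (D powr e) * local_norm M d q \<infinity> \<alpha> r f y \<le> amalgam_norm M d q p \<alpha> f"
        using 2 enn_powr_le_iff[of t] by (metis enn_powr_powr_inverse(1) less_le_trans zero_less_one less_irrefl)
      then have "ennreal (D powr - e) * (ennreal (D powr e) * local_norm M d q \<infinity> \<alpha> r f y) \<le>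
          ennreal (D powr - e) * amalgam_norm M d q p \<alpha> f"
        by (rule mult_left_mono) simp
      moreover have "ennreal (D powr - e) * ennreal (D powr e) = 1"
        using D(1) by (simp flip: ennreal_mult powr_add)
      ultimately show ?thesis by (simp add: mult.assoc[symmetric])
    qed
    moreover have "0 < D powr - e" using D(1) by simp
    ultimately show ?thesis by blast
  qed
qed

text \<open>Writing \<open>H\<close> for the quantity bounded in the previous lemma and \<open>V\<close> for the measure of the ball,
  the integrand of the norm with outer exponent \<open>p\<close> is \<open>V\<^sup>-\<^sup>1 H\<^sup>p\<close>.  The bound on \<open>H\<close> absorbs the
  factor \<open>H\<close> to the power \<open>p' - p\<close> when \<open>p\<close> is raised to \<open>p'\<close>.\<close>

lemma amalgam_norm_mono_p:
  assumes "1 \<le> q" "q \<le> \<alpha>" "\<alpha> \<le> p" "p \<le> p'"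
  shows "\<exists>C>0. \<forall>f\<in>borel_measurable (completion M).
    amalgam_norm M d q p' \<alpha> f \<le> ennreal C * amalgam_norm M d q p \<alpha> f"
proof -
  have "1 \<le> p" "1 \<le> p'" using assms by auto
  obtain C where C: "0 < C" "\<And>f y r. \<lbrakk>f \<in> borel_measurable (completion M); y \<in> space M; 0 < r\<rbrakk> \<Longrightarrow>
      local_norm M d q \<infinity> \<alpha> r f y \<le> ennreal C * amalgam_norm M d q p \<alpha> f"
    using local_norm_le_amalgam_norm[OF assms(1-3)] by blast
  show ?thesis
    using \<open>1 \<le> p'\<close>
  proof (cases rule: exponent_cases)
    case 1
    then have "amalgam_norm M d q p' \<alpha> f \<le> ennreal C * amalgam_norm M d q p \<alpha> f"
      if "f \<in> borel_measurable (completion M)" for f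
      using C(2)[OF that] by (auto simp: amalgam_norm_def amalgam_norm_at_def intro!: SUP_least)
    then show ?thesis using C(1) by blast
  next
    case p': (2 t')
    show ?thesis
      using \<open>1 \<le> p\<close>
    proof (cases rule: exponent_cases)
      case 1
      then show ?thesis using p' assms by (simp add: top_unique)
    next
      case p: (2 t)
      show ?thesis
      proof (cases "t = t'")
        case True
        then show ?thesis using p p' by (intro exI[of _ 1]) auto
      next
        case False
        then have tt': "t < t'" using p p' assms by (simp add: ennreal_le_iff)
        have q: "q \<noteq> \<infinity>" using assms p by (auto simp: top_unique)
        have "amalgam_norm M d q p' \<alpha> f \<le> ennreal (C powr ((t' - t) / t')) * amalgam_norm M d q p \<alpha> f"
          if f: "f \<in> borel_measurable (completion M)" for f
          unfolding amalgam_norm_def[of M d q p']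
        proof (rule SUP_least)
          fix r :: real assume "r \<in> {0<..}"
          then have r: "0 < r" by simp
          let ?N = "amalgam_norm M d q p \<alpha> f"
          let ?S = "enn_powr (ennreal C * ?N) (t' - t)"
          note [measurable] = local_norm_measurable[OF assms(1) q r f]
          have split_t: "enn_powr (local_norm M d q s \<alpha> r f y) \<tau> =
              ennreal (vol y r powr -1) * enn_powr (local_norm M d q \<infinity> \<alpha> r f y) \<tau>"
            if "1 \<le> \<tau>" "recip s = 1 / \<tau>" for s \<tau> y
          proof -
            have "(recip \<alpha> - recip s - recip q) * \<tau> = -1 + (recip \<alpha> - recip \<infinity> - recip q) * \<tau>"
              using that by (simp add: algebra_simps recip_def)
            then have "vol y r powr ((recip \<alpha> - recip s - recip q) * \<tau>) =
                vol y r powr -1 * vol y r powr ((recip \<alpha> - recip \<infinity> - recip q) * \<tau>)"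
              by (simp only: powr_add)
            then show ?thesis
              by (simp only: local_norm_eq enn_powr_mult enn_powr_ennreal[OF powr_ge_zero]
                  powr_powr ennreal_mult[OF powr_ge_zero powr_ge_zero] mult.assoc)
          qed
          have "(\<integral>\<^sup>+y. enn_powr (local_norm M d q p' \<alpha> r f y) t' \<partial>M) \<le>
              (\<integral>\<^sup>+y. ?S * enn_powr (local_norm M d q p \<alpha> r f y) t \<partial>M)"
          proof (rule nn_integral_mono)
            fix y assume y: "y \<in> space M"
            let ?H = "local_norm M d q \<infinity> \<alpha> r f y"
            have "enn_powr ?H t' = enn_powr ?H (t' - t) * enn_powr ?H t"
              by (simp flip: enn_powr_add)
            also have "\<dots> \<le> ?S * enn_powr ?H t"
              using C(2)[OF f y r] tt' by (intro mult_right_mono enn_powr_mono) auto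
            finally have "ennreal (vol y r powr -1) * enn_powr ?H t' \<le>
                ennreal (vol y r powr -1) * (?S * enn_powr ?H t)"
              by (rule mult_left_mono) simp
            then show "enn_powr (local_norm M d q p' \<alpha> r f y) t' \<le>
                ?S * enn_powr (local_norm M d q p \<alpha> r f y) t"
              using p p' by (simp add: split_t mult_ac)
          qed
          also have "\<dots> = ?S * enn_powr (amalgam_norm_at M d q p \<alpha> r f) t"
            using p by (simp add: nn_integral_cmult amalgam_norm_at_def)
          also have "\<dots> \<le> ?S * enn_powr ?N t"
            using p r by (intro mult_left_mono enn_powr_mono amalgam_norm_upper) auto
          also have "\<dots> = enn_powr (ennreal C) (t' - t) * enn_powr ?N t'"
            by (simp add: enn_powr_mult mult.assoc flip: enn_powr_add)
          also have "\<dots> = enn_powr (ennreal (C powr ((t' - t) / t')) * ?N) t'"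
            using C(1) p' by (simp add: enn_powr_mult enn_powr_ennreal powr_powr)
          finally show "amalgam_norm_at M d q p' \<alpha> r f \<le> ennreal (C powr ((t' - t) / t')) * ?N"
            using p' by (simp add: amalgam_norm_at_def enn_powr_le_iff)
        qed
        moreover have "0 < C powr ((t' - t) / t')" using C(1) by simp
        ultimately show ?thesis by blast
      qed
    qed
  qed
qed


section \<open>The Lebesgue norm dominates the amalgam norms\<close>

text \<open>After exchanging the order of integration, the left-hand side integrates \<open>g(x)\<close> times the integral
  of \<open>1 / \<mu>(B(y, r))\<close> over the points \<open>y\<close> at distance less than \<open>r\<close> from \<open>x\<close>.  By doubling the integrand
  is comparable to \<open>1 / \<mu>(B(x, r))\<close>, so the integral is bounded.
  The set of pairs \<open>(x, y)\<close> with \<open>d(x, y) < r\<close> is replaced by the larger union of the products \<open>B(z, 2 \<kappa> r) \<times> B(z, 2 \<kappa> r)\<close> over a countable dense set, because that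
  union is visibly measurable for the product \<open>\<sigma>\<close>-algebra.\<close>

lemma integral_ball_averages_le:
  "\<exists>D\<ge>1. \<forall>g\<in>borel_measurable M. \<forall>r>0.
    (\<integral>\<^sup>+y. ennreal (1 / vol y r) * (\<integral>\<^sup>+x. g x * indicator (ball_at y r) x \<partial>M) \<partial>M)
      \<le> ennreal D * (\<integral>\<^sup>+x. g x \<partial>M)"
proof -
  let ?s = "2 * quasi_const" and ?l = "quasi_const * (2 * quasi_const + 2 * quasi_const)"
  have s: "0 < ?s" "1 \<le> ?s" and l: "0 < ?l" using quasi_const_ge_1 by auto
  obtain D where D: "1 \<le> D" "\<And>x y r. \<lbrakk>x \<in> space M; y \<in> space M; 0 < r; d x y < ?l * r\<rbrakk> \<Longrightarrow>
      vol x (?l * r) \<le> D * vol y r"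
    using vol_comparable[OF l] by blast
  obtain Z where Z: "countable Z" "Z \<subseteq> space M"
    "\<And>y r. y \<in> space M \<Longrightarrow> 0 < r \<Longrightarrow> Z \<inter> ball_at y r \<noteq> {}"
    using dense_sequence by blast
  interpret sigma_finite_measure M by (rule sigma_finite)
  interpret P: pair_sigma_finite M M ..
  have "(\<integral>\<^sup>+y. ennreal (1 / vol y r) * (\<integral>\<^sup>+x. g x * indicator (ball_at y r) x \<partial>M) \<partial>M)
      \<le> ennreal D * (\<integral>\<^sup>+x. g x \<partial>M)"
    if g [measurable]: "g \<in> borel_measurable M" and r: "0 < r" for g r
  proof -
    define U where "U = (\<Union>z\<in>Z. ball_at z (?s * r) \<times> ball_at z (?s * r))"
    have U [measurable]: "U \<in> sets (M \<Otimes>\<^sub>M M)"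
      unfolding U_def using Z(1,2) s r
      by (intro sets.countable_UN') (auto intro!: pair_measureI qball_in_sets)
    note [measurable] = borel_measurable_vol[OF r]
    let ?h = "\<lambda>x y. ennreal (1 / vol y r) * (g x * indicator U (x, y))"
    have in_U: "(x, y) \<in> U" if y: "y \<in> space M" and x: "x \<in> ball_at y r" for x y
    proof -
      obtain z where z: "z \<in> Z" "z \<in> space M" "d y z < r"
        using Z(3)[OF y r] by (auto simp: mem_ball_at)
      have xM: "x \<in> space M" "d y x < r" using x by (auto simp: mem_ball_at)
      have zy: "d z y < r" using z y by (simp add: commute)
      have "1 * r \<le> ?s * r" using s r by (intro mult_right_mono) auto
      then have "y \<in> ball_at z (?s * r)" using zy y by (simp add: mem_ball_at)
      moreover have "x \<in> ball_at z (?s * r)"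
        using quasi_const_triangle_less[OF z(2) xM(1) y zy xM(2)] xM by (simp add: mem_ball_at)
      ultimately show ?thesis using z(1) by (auto simp: U_def)
    qed
    have "(\<integral>\<^sup>+y. ennreal (1 / vol y r) * (\<integral>\<^sup>+x. g x * indicator (ball_at y r) x \<partial>M) \<partial>M)
        \<le> (\<integral>\<^sup>+y. ennreal (1 / vol y r) * (\<integral>\<^sup>+x. g x * indicator U (x, y) \<partial>M) \<partial>M)"
      using in_U by (intro nn_integral_mono mult_left_mono) (auto split: split_indicator)
    also have "\<dots> = (\<integral>\<^sup>+y. \<integral>\<^sup>+x. ?h x y \<partial>M \<partial>M)"
      by (intro nn_integral_cong nn_integral_cmult[symmetric]) measurable
    also have "\<dots> = (\<integral>\<^sup>+x. \<integral>\<^sup>+y. ?h x y \<partial>M \<partial>M)"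
      by (rule P.Fubini') measurable
    also have "\<dots> \<le> (\<integral>\<^sup>+x. ennreal D * g x \<partial>M)"
    proof (rule nn_integral_mono)
      fix x assume x: "x \<in> space M"
      let ?V = "vol x (?l * r)"
      have V: "0 < ?V" "emeasure M (ball_at x (?l * r)) = ennreal ?V"
        using emeasure_ball_at[OF x, of "?l * r"] l r by auto
      have "?h x y \<le> ennreal (D / ?V) * g x * indicator (ball_at x (?l * r)) y"
        if y: "y \<in> space M" for y
      proof (cases "(x, y) \<in> U")
        case True
        then obtain z where z: "z \<in> space M" "d z x < ?s * r" "d z y < ?s * r"
          using Z(2) by (auto simp: U_def mem_ball_at)
        have "d x z < ?s * r" using z(1,2) x commute[of x z] by simp
        then have "d x y < quasi_const * (?s * r + ?s * r)"
          by (rule quasi_const_triangle_less[OF x y z(1) _ z(3)])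
        also have "\<dots> = ?l * r" by (simp add: algebra_simps)
        finally have dxy: "d x y < ?l * r" .
        have "1 / vol y r \<le> D / ?V"
          using D(2)[OF x y r dxy] V emeasure_ball_at(2)[OF y r] by (simp add: field_simps)
        then have "ennreal (1 / vol y r) * g x \<le> ennreal (D / ?V) * g x"
          by (intro mult_right_mono ennreal_leI) auto
        then show ?thesis using True dxy y by (simp add: mem_ball_at)
      qed simp
      then have "(\<integral>\<^sup>+y. ?h x y \<partial>M) \<le>
          (\<integral>\<^sup>+y. ennreal (D / ?V) * g x * indicator (ball_at x (?l * r)) y \<partial>M)"
        by (rule nn_integral_mono)
      also have "\<dots> = ennreal (D / ?V) * g x * ennreal ?V"
      proof -
        have "ball_at x (?l * r) \<in> sets M" using l r x by (intro qball_in_sets) auto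
        then show ?thesis by (simp only: nn_integral_cmult_indicator V(2))
      qed
      also have "\<dots> = (ennreal (D / ?V) * ennreal ?V) * g x" by (simp add: mult_ac)
      also have "ennreal (D / ?V) * ennreal ?V = ennreal D"
        using V D(1) by (simp flip: ennreal_mult)
      finally show "(\<integral>\<^sup>+y. ?h x y \<partial>M) \<le> ennreal D * g x" .
    qed
    also have "\<dots> = ennreal D * (\<integral>\<^sup>+x. g x \<partial>M)" by (rule nn_integral_cmult) simp
    finally show ?thesis .
  qed
  with D(1) show ?thesis by blast
qed

text \<open>For finite \<open>\<alpha>\<close> the integrand is \<open>V\<^sup>-\<^sup>1\<close> times the integral of \<open>|f|\<^sup>\<alpha>\<close> over the ball, which is the
  situation of the previous lemma once \<open>|f|\<^sup>\<alpha>\<close> is replaced by a Borel function equal to it almost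
  everywhere.\<close>

lemma amalgam_norm_diagonal_le:
  assumes "1 \<le> \<alpha>"
  shows "\<exists>C>0. \<forall>f\<in>borel_measurable (completion M).
    amalgam_norm M d \<alpha> \<alpha> \<alpha> f \<le> ennreal C * Lnorm (completion M) \<alpha> f"
  using assms
proof (cases rule: exponent_cases)
  case 1
  have "local_norm M d \<infinity> \<infinity> \<infinity> r f y \<le> Lnorm (completion M) \<infinity> f"
    if f: "f \<in> borel_measurable (completion M)" and y: "y \<in> space M" "0 < r" for f y r
  proof -
    have "local_norm M d \<infinity> \<infinity> \<infinity> r f y =
        lp_norm (completion M) \<infinity> (\<lambda>x. ennreal (cmod (f x)) * indicator (ball_at y r) x)"
      using emeasure_ball_at(2)[OF y] by (simp add: local_norm_eq recip_def)
    also have "\<dots> \<le> lp_norm (completion M) \<infinity> (\<lambda>x. ennreal (cmod (f x)))"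
      using f y by (intro lp_norm_mono_AE borel_measurable_cut) (auto split: split_indicator)
    finally show ?thesis by (simp add: Lnorm_eq_lp_norm)
  qed
  then show ?thesis
    using 1 by (intro exI[of _ 1]) (auto simp: amalgam_norm_def amalgam_norm_at_def intro!: SUP_least)
next
  case (2 t)
  obtain D where D: "1 \<le> D" "\<And>g r. \<lbrakk>g \<in> borel_measurable M; 0 < r\<rbrakk> \<Longrightarrow>
      (\<integral>\<^sup>+y. ennreal (1 / vol y r) * (\<integral>\<^sup>+x. g x * indicator (ball_at y r) x \<partial>M) \<partial>M)
        \<le> ennreal D * (\<integral>\<^sup>+x. g x \<partial>M)"
    using integral_ball_averages_le by blast
  have "amalgam_norm_at M d \<alpha> \<alpha> \<alpha> r f \<le> ennreal (D powr (1 / t)) * Lnorm (completion M) \<alpha> f"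
    if f [measurable]: "f \<in> borel_measurable (completion M)" and r: "0 < r" for f r
  proof -
    have "(\<lambda>x. enn_powr (ennreal (cmod (f x))) t) \<in> borel_measurable (completion M)" by measurable
    then obtain g where g [measurable]: "g \<in> borel_measurable M"
      and fg: "AE x in M. enn_powr (ennreal (cmod (f x))) t = g x"
      using completion_ex_borel_measurable by blast
    have loc: "enn_powr (local_norm M d \<alpha> \<alpha> \<alpha> r f y) t =
        ennreal (1 / vol y r) * (\<integral>\<^sup>+x. g x * indicator (ball_at y r) x \<partial>M)" if y: "y \<in> space M" for y
    proof -
      have cut: "enn_powr (ennreal (cmod (f x)) * indicator (ball_at y r) x) t =
          enn_powr (ennreal (cmod (f x))) t * indicator (ball_at y r) x" for x
        by (auto split: split_indicator)
      have "(\<integral>\<^sup>+x. enn_powr (ennreal (cmod (f x)) * indicator (ball_at y r) x) t \<partial>completion M) =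
          (\<integral>\<^sup>+x. g x * indicator (ball_at y r) x \<partial>M)"
        unfolding nn_integral_completion cut
        by (rule nn_integral_cong_AE, use fg in eventually_elim) simp
      moreover have "enn_powr (ennreal (vol y r powr (recip \<alpha> - recip \<alpha> - recip \<alpha>))) t = ennreal (1 / vol y r)"
      proof -
        have "(recip \<alpha> - recip \<alpha> - recip \<alpha>) * t = -1" using 2 by simp
        then show ?thesis
          using emeasure_ball_at(2)[OF y r]
          by (simp only: enn_powr_ennreal[OF powr_ge_zero] powr_powr) (simp add: powr_minus_divide)
      qed
      ultimately show ?thesis
        using 2 by (simp add: local_norm_eq enn_powr_mult lp_norm_ennreal)
    qed
    have "(\<integral>\<^sup>+y. enn_powr (local_norm M d \<alpha> \<alpha> \<alpha> r f y) t \<partial>M) =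
        (\<integral>\<^sup>+y. ennreal (1 / vol y r) * (\<integral>\<^sup>+x. g x * indicator (ball_at y r) x \<partial>M) \<partial>M)"
      using loc by (rule nn_integral_cong)
    also have "\<dots> \<le> ennreal D * (\<integral>\<^sup>+x. g x \<partial>M)" by (rule D(2)[OF g r])
    also have "(\<integral>\<^sup>+x. g x \<partial>M) = (\<integral>\<^sup>+x. enn_powr (ennreal (cmod (f x))) t \<partial>completion M)"
      unfolding nn_integral_completion by (rule nn_integral_cong_AE, use fg in eventually_elim) simp
    also have "\<dots> = enn_powr (Lnorm (completion M) \<alpha> f) t"
      using 2 by (simp add: Lnorm_eq_lp_norm lp_norm_ennreal)
    also have "ennreal D * \<dots> = enn_powr (ennreal (D powr (1 / t)) * Lnorm (completion M) \<alpha> f) t"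
      using 2 D(1) by (simp add: enn_powr_mult enn_powr_ennreal powr_powr)
    finally show ?thesis using 2 by (simp add: amalgam_norm_at_def enn_powr_le_iff)
  qed
  moreover have "0 < D powr (1 / t)" using D(1) by simp
  ultimately show ?thesis
    unfolding amalgam_norm_def by (intro exI[of _ "D powr (1 / t)"]) (auto intro!: SUP_least)
qed

lemma amalgam_norm_le_Lnorm:
  assumes "1 \<le> q" "q \<le> \<alpha>" "\<alpha> \<le> p"
  shows "\<exists>C>0. \<forall>f\<in>borel_measurable (completion M).
    amalgam_norm M d q p \<alpha> f \<le> ennreal C * Lnorm (completion M) \<alpha> f"
proof -
  have ord: "1 \<le> \<alpha>" "1 \<le> p" using assms by auto
  obtain C1 where C1: "0 < C1" "\<And>f. f \<in> borel_measurable (completion M) \<Longrightarrow>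
      amalgam_norm M d \<alpha> p \<alpha> f \<le> ennreal C1 * amalgam_norm M d \<alpha> \<alpha> \<alpha> f"
    using amalgam_norm_mono_p[OF ord(1) order_refl order_refl assms(3)] by blast
  obtain C2 where C2: "0 < C2" "\<And>f. f \<in> borel_measurable (completion M) \<Longrightarrow>
      amalgam_norm M d \<alpha> \<alpha> \<alpha> f \<le> ennreal C2 * Lnorm (completion M) \<alpha> f"
    using amalgam_norm_diagonal_le[OF ord(1)] by blast
  have "amalgam_norm M d q p \<alpha> f \<le> ennreal (C1 * C2) * Lnorm (completion M) \<alpha> f"
    if f: "f \<in> borel_measurable (completion M)" for f
  proof -
    have "amalgam_norm M d q p \<alpha> f \<le> amalgam_norm M d \<alpha> p \<alpha> f"
      using amalgam_norm_mono_q[OF assms(1,2) ord(2) f] .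
    also have "\<dots> \<le> ennreal C1 * amalgam_norm M d \<alpha> \<alpha> \<alpha> f" by (rule C1(2)[OF f])
    also have "\<dots> \<le> ennreal C1 * (ennreal C2 * Lnorm (completion M) \<alpha> f)"
      using C2(2)[OF f] by (rule mult_left_mono) simp
    also have "\<dots> = ennreal (C1 * C2) * Lnorm (completion M) \<alpha> f"
      using C1(1) C2(1) by (simp add: ennreal_mult mult.assoc)
    finally show ?thesis .
  qed
  moreover have "0 < C1 * C2" using C1(1) C2(1) by simp
  ultimately show ?thesis by blast
qed

section \<open>The amalgam norm as a norm on functions\<close>

lemma local_norm_triangle:
  assumes "1 \<le> q" "y \<in> space M" "0 < r"
    and f: "f \<in> borel_measurable (completion M)" and g: "g \<in> borel_measurable (completion M)"
  shows "local_norm M d q p \<alpha> r (\<lambda>x. f x + g x) y \<le> local_norm M d q p \<alpha> r f y + local_norm M d q p \<alpha> r g y"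
proof -
  let ?u = "\<lambda>f x. ennreal (cmod (f x)) * indicator (ball_at y r) x"
  have meas: "?u h \<in> borel_measurable (completion M)" if "h \<in> borel_measurable (completion M)" for h
    using that assms by (intro borel_measurable_cut)
  have "?u (\<lambda>x. f x + g x) x \<le> ?u f x + ?u g x" for x
  proof (cases "x \<in> ball_at y r")
    case True
    have "ennreal (cmod (f x + g x)) \<le> ennreal (cmod (f x) + cmod (g x))"
      by (intro ennreal_leI norm_triangle_ineq)
    also have "\<dots> = ennreal (cmod (f x)) + ennreal (cmod (g x))" by (intro ennreal_plus) auto
    finally show ?thesis using True by simp
  qed simp
  then have "lp_norm (completion M) q (?u (\<lambda>x. f x + g x)) \<le> lp_norm (completion M) q (\<lambda>x. ?u f x + ?u g x)"
    using assms f g by (intro lp_norm_mono_AE meas) auto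
  also have "\<dots> \<le> lp_norm (completion M) q (?u f) + lp_norm (completion M) q (?u g)"
    using assms by (intro lp_norm_triangle meas)
  finally show ?thesis
    unfolding local_norm_eq distrib_left[symmetric] by (rule mult_left_mono) simp
qed

lemma local_norm_cmult_le:
  assumes "1 \<le> q" "y \<in> space M" "0 < r" "f \<in> borel_measurable (completion M)"
  shows "local_norm M d q p \<alpha> r (\<lambda>x. c * f x) y \<le> ennreal (cmod c) * local_norm M d q p \<alpha> r f y"
proof -
  let ?u = "\<lambda>x. ennreal (cmod (f x)) * indicator (ball_at y r) x"
  have "lp_norm (completion M) q (\<lambda>x. ennreal (cmod c) * ?u x) \<le> ennreal (cmod c) * lp_norm (completion M) q ?u"
    using assms by (intro lp_norm_cmult_le borel_measurable_cut)
  then have "ennreal (vol y r powr (recip \<alpha> - recip p - recip q)) *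
      lp_norm (completion M) q (\<lambda>x. ennreal (cmod c) * ?u x) \<le>
      ennreal (vol y r powr (recip \<alpha> - recip p - recip q)) * (ennreal (cmod c) * lp_norm (completion M) q ?u)"
    by (rule mult_left_mono) simp
  then show ?thesis by (simp add: local_norm_eq norm_mult ennreal_mult mult_ac)
qed

lemma local_norm_fatou:
  assumes "1 \<le> q" "y \<in> space M" "0 < r"
    and f: "f \<in> borel_measurable (completion M)" and h: "\<And>n. h n \<in> borel_measurable (completion M)"
    and lim: "AE x in M. (\<lambda>n. h n x) \<longlonglongrightarrow> f x"
  shows "local_norm M d q p \<alpha> r f y \<le> liminf (\<lambda>n. local_norm M d q p \<alpha> r (h n) y)"
proof -
  let ?c = "ennreal (vol y r powr (recip \<alpha> - recip p - recip q))"
  let ?u = "\<lambda>f x. ennreal (cmod (f x)) * indicator (ball_at y r) x"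
  have meas: "?u f \<in> borel_measurable (completion M)" if "f \<in> borel_measurable (completion M)" for f
    using borel_measurable_cut[OF that assms(2,3)] .
  have "AE x in completion M. ?u f x \<le> liminf (\<lambda>n. ?u (h n) x)"
    using AE_completion[OF lim]
  proof eventually_elim
    fix x assume x: "(\<lambda>n. h n x) \<longlonglongrightarrow> f x"
    show "?u f x \<le> liminf (\<lambda>n. ?u (h n) x)"
    proof (cases "x \<in> ball_at y r")
      case True
      have "(\<lambda>n. ennreal (cmod (h n x))) \<longlonglongrightarrow> ennreal (cmod (f x))"
        using x by (intro tendsto_ennrealI tendsto_norm)
      then have "liminf (\<lambda>n. ennreal (cmod (h n x))) = ennreal (cmod (f x))"
        by (rule lim_imp_Liminf[OF sequentially_bot])
      then show ?thesis using True by simp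
    qed simp
  qed
  then have "lp_norm (completion M) q (?u f) \<le> liminf (\<lambda>n. lp_norm (completion M) q (?u (h n)))"
    using assms(1) f h by (intro lp_norm_fatou meas)
  then have "?c * lp_norm (completion M) q (?u f) \<le> ?c * liminf (\<lambda>n. lp_norm (completion M) q (?u (h n)))"
    by (rule mult_left_mono) simp
  also have "\<dots> = liminf (\<lambda>n. ?c * lp_norm (completion M) q (?u (h n)))"
    by (rule Liminf_compose_continuous_mono[symmetric])
       (auto intro!: ennreal_continuous_on_cmult continuous_on_id monotone_onI mult_left_mono)
  finally show ?thesis unfolding local_norm_eq .
qed

lemma amalgam_norm_at_triangle:
  assumes qp: "1 \<le> q" "q \<le> p" and r: "0 < r"
    and f: "f \<in> borel_measurable (completion M)" and g: "g \<in> borel_measurable (completion M)"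
  shows "amalgam_norm_at M d q p \<alpha> r (\<lambda>x. f x + g x) \<le> amalgam_norm_at M d q p \<alpha> r f + amalgam_norm_at M d q p \<alpha> r g"
proof (cases "p = \<infinity>")
  case True
  have "local_norm M d q \<infinity> \<alpha> r (\<lambda>x. f x + g x) y \<le>
      (SUP y\<in>space M. local_norm M d q \<infinity> \<alpha> r f y) + (SUP y\<in>space M. local_norm M d q \<infinity> \<alpha> r g y)"
    if y: "y \<in> space M" for y
    using y by (intro order_trans[OF local_norm_triangle[OF qp(1) y r f g]] add_mono SUP_upper)
  then show ?thesis unfolding amalgam_norm_at_def using True by (auto intro!: SUP_least)
next
  case False
  have p: "1 \<le> p" and q: "q \<noteq> \<infinity>" using qp False by (auto simp: top_unique)
  have fg: "(\<lambda>x. f x + g x) \<in> borel_measurable (completion M)" using f g by measurable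
  note meas = local_norm_measurable[OF qp(1) q r]
  have "lp_norm M p (local_norm M d q p \<alpha> r (\<lambda>x. f x + g x)) \<le>
      lp_norm M p (\<lambda>y. local_norm M d q p \<alpha> r f y + local_norm M d q p \<alpha> r g y)"
    using p meas[OF fg] local_norm_triangle[OF qp(1) _ r f g] by (intro lp_norm_mono_AE) auto
  also have "\<dots> \<le> lp_norm M p (local_norm M d q p \<alpha> r f) + lp_norm M p (local_norm M d q p \<alpha> r g)"
    by (rule lp_norm_triangle[OF p meas[OF f] meas[OF g]])
  finally show ?thesis using p False by (simp add: amalgam_norm_at_finite)
qed

lemma amalgam_norm_triangle:
  assumes "1 \<le> q" "q \<le> p"
    and "f \<in> borel_measurable (completion M)" "g \<in> borel_measurable (completion M)"
  shows "amalgam_norm M d q p \<alpha> (\<lambda>x. f x + g x) \<le> amalgam_norm M d q p \<alpha> f + amalgam_norm M d q p \<alpha> g"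
  unfolding amalgam_norm_def[of _ _ _ _ _ "\<lambda>x. f x + g x"]
  using amalgam_norm_at_triangle[OF assms(1,2) _ assms(3,4)] amalgam_norm_upper
  by (intro SUP_least) (meson add_mono greaterThan_iff order_trans)

lemma amalgam_norm_cmult_le:
  assumes qp: "1 \<le> q" "q \<le> p" and f: "f \<in> borel_measurable (completion M)"
  shows "amalgam_norm M d q p \<alpha> (\<lambda>x. c * f x) \<le> ennreal (cmod c) * amalgam_norm M d q p \<alpha> f"
  unfolding amalgam_norm_def[of _ _ _ _ _ "\<lambda>x. c * f x"]
proof (rule SUP_least)
  fix r :: real assume "r \<in> {0<..}"
  then have r: "0 < r" by simp
  note loc = local_norm_cmult_le[OF qp(1) _ r f]
  have "amalgam_norm_at M d q p \<alpha> r (\<lambda>x. c * f x) \<le> ennreal (cmod c) * amalgam_norm_at M d q p \<alpha> r f"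
  proof (cases "p = \<infinity>")
    case True
    have "local_norm M d q \<infinity> \<alpha> r (\<lambda>x. c * f x) y \<le>
        ennreal (cmod c) * (SUP y\<in>space M. local_norm M d q \<infinity> \<alpha> r f y)" if y: "y \<in> space M" for y
      using loc[OF y] by (rule order_trans) (use y in \<open>auto intro!: mult_left_mono SUP_upper\<close>)
    then show ?thesis unfolding amalgam_norm_at_def using True by (auto intro!: SUP_least)
  next
    case False
    have p: "1 \<le> p" and q: "q \<noteq> \<infinity>" using qp False by (auto simp: top_unique)
    have cf: "(\<lambda>x. c * f x) \<in> borel_measurable (completion M)" using f by measurable
    note meas = local_norm_measurable[OF qp(1) q r]
    have "lp_norm M p (local_norm M d q p \<alpha> r (\<lambda>x. c * f x)) \<le>
        lp_norm M p (\<lambda>y. ennreal (cmod c) * local_norm M d q p \<alpha> r f y)"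
      using p meas[OF cf] loc by (intro lp_norm_mono_AE) auto
    also have "\<dots> \<le> ennreal (cmod c) * lp_norm M p (local_norm M d q p \<alpha> r f)"
      by (rule lp_norm_cmult_le[OF p meas[OF f]])
    finally show ?thesis using p False by (simp add: amalgam_norm_at_finite)
  qed
  also have "\<dots> \<le> ennreal (cmod c) * amalgam_norm M d q p \<alpha> f"
    using amalgam_norm_upper[OF r] by (rule mult_left_mono) simp
  finally show "amalgam_norm_at M d q p \<alpha> r (\<lambda>x. c * f x) \<le> ennreal (cmod c) * amalgam_norm M d q p \<alpha> f" .
qed

lemma amalgam_norm_zero: "1 \<le> q \<Longrightarrow> q \<le> p \<Longrightarrow> amalgam_norm M d q p \<alpha> (\<lambda>x. 0) = 0"
  using amalgam_norm_cmult_le[of q p "\<lambda>x. 0" \<alpha> 0] by simp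

lemma amalgam_norm_cmult:
  assumes qp: "1 \<le> q" "q \<le> p" and f: "f \<in> borel_measurable (completion M)"
  shows "amalgam_norm M d q p \<alpha> (\<lambda>x. c * f x) = ennreal (cmod c) * amalgam_norm M d q p \<alpha> f"
proof (cases "c = 0")
  case True
  then show ?thesis using amalgam_norm_zero[OF qp] by simp
next
  case False
  have cf: "(\<lambda>x. c * f x) \<in> borel_measurable (completion M)" using f by measurable
  have "amalgam_norm M d q p \<alpha> f \<le> ennreal (cmod (inverse c)) * amalgam_norm M d q p \<alpha> (\<lambda>x. c * f x)"
    using amalgam_norm_cmult_le[OF qp cf, of \<alpha> "inverse c"] False by (simp flip: mult.assoc)
  then have "ennreal (cmod c) * amalgam_norm M d q p \<alpha> f \<le>
      ennreal (cmod c) * (ennreal (cmod (inverse c)) * amalgam_norm M d q p \<alpha> (\<lambda>x. c * f x))"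
    by (rule mult_left_mono) simp
  also have "\<dots> = amalgam_norm M d q p \<alpha> (\<lambda>x. c * f x)"
    using False by (simp add: norm_inverse flip: mult.assoc ennreal_mult)
  finally show ?thesis using amalgam_norm_cmult_le[OF qp f, of \<alpha> c] by simp
qed

lemma amalgam_norm_diff_commute:
  assumes "1 \<le> q" "q \<le> p"
    and "f \<in> borel_measurable (completion M)" "g \<in> borel_measurable (completion M)"
  shows "amalgam_norm M d q p \<alpha> (\<lambda>x. f x - g x) = amalgam_norm M d q p \<alpha> (\<lambda>x. g x - f x)"
  using amalgam_norm_cmult[OF assms(1,2), of "\<lambda>x. g x - f x" \<alpha> "-1"] assms(3,4) by simp

text \<open>Lower semicontinuity under almost everywhere convergence survives the suprema over centres and
  radii as well as the outer integral.\<close>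

lemma amalgam_norm_fatou:
  assumes qp: "1 \<le> q" "q \<le> p"
    and f: "f \<in> borel_measurable (completion M)" and h: "\<And>n. h n \<in> borel_measurable (completion M)"
    and lim: "AE x in M. (\<lambda>n. h n x) \<longlonglongrightarrow> f x"
  shows "amalgam_norm M d q p \<alpha> f \<le> liminf (\<lambda>n. amalgam_norm M d q p \<alpha> (h n))"
  unfolding amalgam_norm_def[of _ _ _ _ _ f]
proof (rule SUP_least)
  fix r :: real assume "r \<in> {0<..}"
  then have r: "0 < r" by simp
  note loc = local_norm_fatou[OF qp(1) _ r f h lim]
  have "amalgam_norm_at M d q p \<alpha> r f \<le> liminf (\<lambda>n. amalgam_norm_at M d q p \<alpha> r (h n))"
  proof (cases "p = \<infinity>")
    case True
    have "local_norm M d q \<infinity> \<alpha> r f y \<le> liminf (\<lambda>n. SUP y\<in>space M. local_norm M d q \<infinity> \<alpha> r (h n) y)"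
      if y: "y \<in> space M" for y
      using loc[OF y] by (rule order_trans) (use y in \<open>auto intro!: Liminf_mono always_eventually SUP_upper\<close>)
    then show ?thesis unfolding amalgam_norm_at_def using True by (auto intro!: SUP_least)
  next
    case False
    have p: "1 \<le> p" and q: "q \<noteq> \<infinity>" using qp False by (auto simp: top_unique)
    note meas = local_norm_measurable[OF qp(1) q r]
    have "lp_norm M p (local_norm M d q p \<alpha> r f) \<le> liminf (\<lambda>n. lp_norm M p (local_norm M d q p \<alpha> r (h n)))"
      using loc by (intro lp_norm_fatou p meas f h) auto
    then show ?thesis using p False by (simp add: amalgam_norm_at_finite)
  qed
  also have "\<dots> \<le> liminf (\<lambda>n. amalgam_norm M d q p \<alpha> (h n))"
    using amalgam_norm_upper[OF r] by (intro Liminf_mono) simp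
  finally show "amalgam_norm_at M d q p \<alpha> r f \<le> liminf (\<lambda>n. amalgam_norm M d q p \<alpha> (h n))" .
qed

text \<open>Local norms with inner exponent \<open>1\<close> are multiples of integrals over balls.  The resulting
  continuous embedding into \<open>L\<^sup>1\<close> of each ball gives both the definiteness of the norm and
  the almost everywhere convergence of rapidly convergent sequences.\<close>

lemma integral_ball_le_amalgam_norm:
  assumes qp: "1 \<le> q" "q \<le> \<alpha>" "\<alpha> \<le> p" and y: "y \<in> space M" and r: "0 < r"
  shows "\<exists>c\<ge>0. \<forall>f\<in>borel_measurable (completion M).
    (\<integral>\<^sup>+x. ennreal (cmod (f x)) * indicator (ball_at y r) x \<partial>completion M) \<le> ennreal c * amalgam_norm M d q p \<alpha> f"
proof -
  obtain C where C: "0 < C" "\<And>f. f \<in> borel_measurable (completion M) \<Longrightarrow>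
      local_norm M d q \<infinity> \<alpha> r f y \<le> ennreal C * amalgam_norm M d q p \<alpha> f"
    using local_norm_le_amalgam_norm[OF qp] y r by blast
  let ?e = "recip \<alpha> - recip \<infinity> - recip 1"
  have "(\<integral>\<^sup>+x. ennreal (cmod (f x)) * indicator (ball_at y r) x \<partial>completion M) \<le>
      ennreal (vol y r powr - ?e * C) * amalgam_norm M d q p \<alpha> f"
    if f: "f \<in> borel_measurable (completion M)" for f
  proof -
    let ?I = "\<integral>\<^sup>+x. ennreal (cmod (f x)) * indicator (ball_at y r) x \<partial>completion M"
    have "ennreal (vol y r powr ?e) * ?I = local_norm M d 1 \<infinity> \<alpha> r f y"
      by (simp add: local_norm_eq lp_norm_ennreal[of 1, simplified])
    also have "\<dots> \<le> ennreal C * amalgam_norm M d q p \<alpha> f"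
      using local_norm_mono_q[OF _ qp(1) y r f, of \<infinity> \<alpha>] C(2)[OF f] by (simp add: order_trans)
    finally have "ennreal (vol y r powr - ?e) * (ennreal (vol y r powr ?e) * ?I) \<le>
        ennreal (vol y r powr - ?e) * (ennreal C * amalgam_norm M d q p \<alpha> f)"
      by (rule mult_left_mono) simp
    moreover have "ennreal (vol y r powr - ?e) * ennreal (vol y r powr ?e) = 1"
    proof -
      have "vol y r powr - ?e * vol y r powr ?e = 1"
        using emeasure_ball_at(2)[OF y r] by (simp only: powr_add[symmetric]) simp
      then show ?thesis by (simp only: ennreal_mult[symmetric] powr_ge_zero ennreal_1)
    qed
    moreover have "ennreal (vol y r powr - ?e) * ennreal C = ennreal (vol y r powr - ?e * C)"
      using C(1) by (simp only: ennreal_mult[symmetric] powr_ge_zero less_imp_le)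
    ultimately show ?thesis by (simp only: mult.assoc[symmetric] mult_1)
  qed
  moreover have "0 \<le> vol y r powr - ?e * C" using C(1) by (intro mult_nonneg_nonneg) auto
  ultimately show ?thesis by blast
qed

lemma amalgam_norm_eq_0D:
  assumes qp: "1 \<le> q" "q \<le> \<alpha>" "\<alpha> \<le> p"
    and f: "f \<in> borel_measurable (completion M)" and zero: "amalgam_norm M d q p \<alpha> f = 0"
  shows "AE x in M. f x = 0"
proof -
  obtain y where y: "y \<in> space M" using space_nonempty by blast
  have "AE x in completion M. x \<in> ball_at y (real n + 1) \<longrightarrow> f x = 0" for n :: nat
  proof -
    let ?u = "\<lambda>x. ennreal (cmod (f x)) * indicator (ball_at y (real n + 1)) x"
    have "(\<integral>\<^sup>+x. ?u x \<partial>completion M) = 0"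
      using integral_ball_le_amalgam_norm[OF qp y, of "real n + 1"] f zero by auto
    then have "AE x in completion M. ?u x = 0"
      using borel_measurable_cut[OF f y, of "real n + 1"] by (subst (asm) nn_integral_0_iff_AE) auto
    then show ?thesis by eventually_elim (auto split: split_indicator_asm)
  qed
  then have "AE x in completion M. \<forall>n::nat. x \<in> ball_at y (real n + 1) \<longrightarrow> f x = 0"
    by (intro AE_all_countable[THEN iffD2] allI)
  then have "AE x in completion M. f x = 0"
    using AE_space by eventually_elim (use space_eq_UN_balls[OF y] in auto)
  then show ?thesis by (simp add: AE_completion_iff)
qed


text \<open>Along a subsequence whose consecutive differences have
  norms at most \<open>2\<^sup>-\<^sup>j\<close>, the series of these differences converges absolutely in \<open>L\<^sup>1\<close> of every ball,
  hence almost everywhere.  The almost everywhere limit of the subsequence is the limit in norm of the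
  whole sequence by \<open>amalgam_norm_fatou\<close>.\<close>

lemma amalgam_norm_complete:
  assumes qp: "1 \<le> q" "q \<le> \<alpha>" "\<alpha> \<le> p"
    and f [measurable]: "\<And>n::nat. f n \<in> borel_measurable (completion M)"
    and Cauchy: "\<And>\<epsilon>. 0 < \<epsilon> \<Longrightarrow> \<exists>K. \<forall>m\<ge>K. \<forall>n\<ge>K. amalgam_norm M d q p \<alpha> (\<lambda>x. f m x - f n x) \<le> ennreal \<epsilon>"
  shows "\<exists>g\<in>borel_measurable (completion M).
    \<forall>\<epsilon>>0. \<exists>K. \<forall>n\<ge>K. amalgam_norm M d q p \<alpha> (\<lambda>x. f n x - g x) \<le> ennreal \<epsilon>"
proof -
  let ?N = "amalgam_norm M d q p \<alpha>"
  have qp': "q \<le> p" using qp by simp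
  have "\<forall>j::nat. \<exists>K. \<forall>m\<ge>K. \<forall>n\<ge>K. ?N (\<lambda>x. f m x - f n x) \<le> ennreal ((1 / 2) ^ j)"
    using Cauchy by simp
  then obtain K where K: "\<And>j m n. K j \<le> m \<Longrightarrow> K j \<le> n \<Longrightarrow> ?N (\<lambda>x. f m x - f n x) \<le> ennreal ((1 / 2) ^ j)"
    by metis
  \<comment> \<open>The summand \<open>j\<close> makes the indices tend to infinity; the partial sums dominate \<open>K j\<close> and increase.\<close>
  define k where "k j = j + (\<Sum>i\<le>j. K i)" for j
  have k_ge: "j \<le> k j" "K j \<le> k j" "k j \<le> k (Suc j)" for j
    using member_le_sum[of j "{..j}" K] by (auto simp: k_def)
  define G where "G j x = f (k (Suc j)) x - f (k j) x" for j x
  have G [measurable]: "G j \<in> borel_measurable (completion M)" for j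
    unfolding G_def by measurable
  have NG: "?N (G j) \<le> ennreal ((1 / 2) ^ j)" for j
    using K[of j "k (Suc j)" "k j"] k_ge[of j] unfolding G_def by linarith
  obtain y where y: "y \<in> space M" using space_nonempty by blast
  have "AE x in completion M. x \<in> ball_at y (real n + 1) \<longrightarrow> convergent (\<lambda>j. f (k j) x)" for n :: nat
  proof -
    let ?B = "ball_at y (real n + 1)"
    let ?u = "\<lambda>j x. ennreal (cmod (G j x)) * indicator ?B x"
    obtain c where c: "0 \<le> c" "\<And>g. g \<in> borel_measurable (completion M) \<Longrightarrow>
        (\<integral>\<^sup>+x. ennreal (cmod (g x)) * indicator ?B x \<partial>completion M) \<le> ennreal c * ?N g"
      using integral_ball_le_amalgam_norm[OF qp y, of "real n + 1"] by auto
    have u [measurable]: "?u j \<in> borel_measurable (completion M)" for j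
      using borel_measurable_cut[OF G y] by simp
    have "(\<integral>\<^sup>+x. (\<Sum>j. ?u j x) \<partial>completion M) = (\<Sum>j. \<integral>\<^sup>+x. ?u j x \<partial>completion M)"
      by (rule nn_integral_suminf) (rule u)
    also have "\<dots> \<le> (\<Sum>j. ennreal (c * (1 / 2) ^ j))"
    proof (rule suminf_le)
      fix j
      have "(\<integral>\<^sup>+x. ?u j x \<partial>completion M) \<le> ennreal c * ennreal ((1 / 2) ^ j)"
        using c(2)[OF G[of j]] mult_left_mono[OF NG[of j], of "ennreal c"] by (rule order_trans) simp
      then show "(\<integral>\<^sup>+x. ?u j x \<partial>completion M) \<le> ennreal (c * (1 / 2) ^ j)"
        using c(1) by (simp add: ennreal_mult)
    qed auto
    also have "\<dots> = ennreal (\<Sum>j. c * (1 / 2) ^ j)"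
      using c(1) by (intro suminf_ennreal2 summable_mult summable_geometric) auto
    finally have "(\<integral>\<^sup>+x. (\<Sum>j. ?u j x) \<partial>completion M) \<noteq> \<infinity>"
      by (auto simp: top_unique)
    then have "AE x in completion M. (\<Sum>j. ?u j x) \<noteq> \<infinity>"
      by (rule nn_integral_PInf_AE[rotated]) (rule borel_measurable_suminf_order, rule u)
    then show ?thesis
    proof eventually_elim
      fix x assume fin: "(\<Sum>j. ?u j x) \<noteq> \<infinity>"
      show "x \<in> ?B \<longrightarrow> convergent (\<lambda>j. f (k j) x)"
      proof
        assume "x \<in> ?B"
        then have "summable (\<lambda>j. cmod (G j x))"
          using fin by (intro summable_suminf_not_top) auto
        then have "summable (\<lambda>j. G j x)" by (rule summable_norm_cancel)
        then have "convergent (\<lambda>m. \<Sum>j<m. G j x)" by (simp add: summable_iff_convergent)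
        moreover have "(\<Sum>j<m. G j x) = f (k m) x - f (k 0) x" for m
          unfolding G_def by (rule sum_lessThan_telescope)
        ultimately have "convergent (\<lambda>m. f (k m) x - f (k 0) x)" by simp
        then have "convergent (\<lambda>m. f (k m) x - f (k 0) x + f (k 0) x)"
          by (rule convergent_add[OF _ convergent_const])
        then show "convergent (\<lambda>j. f (k j) x)" by simp
      qed
    qed
  qed
  then have "AE x in completion M. \<forall>n::nat. x \<in> ball_at y (real n + 1) \<longrightarrow> convergent (\<lambda>j. f (k j) x)"
    by (intro AE_all_countable[THEN iffD2] allI)
  then have conv: "AE x in completion M. convergent (\<lambda>j. f (k j) x)"
    using AE_space by eventually_elim (use space_eq_UN_balls[OF y] in auto)
  define g where "g x = lim (\<lambda>j. f (k j) x)" for x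
  have g [measurable]: "g \<in> borel_measurable (completion M)" unfolding g_def by measurable
  have lim: "AE x in completion M. (\<lambda>j. f (k j) x) \<longlonglongrightarrow> g x"
    using conv by eventually_elim (simp add: g_def convergent_LIMSEQ_iff)
  have "\<exists>K. \<forall>n\<ge>K. ?N (\<lambda>x. f n x - g x) \<le> ennreal \<epsilon>" if \<epsilon>: "0 < \<epsilon>" for \<epsilon>
  proof -
    obtain L where L: "\<And>m n. L \<le> m \<Longrightarrow> L \<le> n \<Longrightarrow> ?N (\<lambda>x. f m x - f n x) \<le> ennreal \<epsilon>"
      using Cauchy[OF \<epsilon>] by blast
    have "?N (\<lambda>x. f n x - g x) \<le> ennreal \<epsilon>" if n: "L \<le> n" for n
    proof -
      have "AE x in M. (\<lambda>j. f n x - f (k j) x) \<longlonglongrightarrow> f n x - g x"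
        using lim unfolding AE_completion_iff by eventually_elim (intro tendsto_diff tendsto_const)
      then have "?N (\<lambda>x. f n x - g x) \<le> liminf (\<lambda>j. ?N (\<lambda>x. f n x - f (k j) x))"
        by (intro amalgam_norm_fatou qp(1) qp') measurable
      also have "\<dots> \<le> liminf (\<lambda>j. ennreal \<epsilon>)"
      proof (rule Liminf_mono)
        have "?N (\<lambda>x. f n x - f (k j) x) \<le> ennreal \<epsilon>" if "L \<le> j" for j
          using L[OF n, of "k j"] k_ge(1)[of j] that by simp
        then show "\<forall>\<^sub>F j in sequentially. ?N (\<lambda>x. f n x - f (k j) x) \<le> ennreal \<epsilon>"
          by (auto simp: eventually_sequentially)
      qed
      finally show ?thesis by (simp add: Liminf_const)
    qed
    then show ?thesis by blast
  qed
  with g show ?thesis by blast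
qed

end

section \<open>The Banach space of classes\<close>

lemma complex_ring_cring: "cring complex_ring"
proof (rule cringI)
  show "abelian_group complex_ring"
  proof (rule abelian_groupI)
    show "\<exists>y\<in>carrier complex_ring. y \<oplus>\<^bsub>complex_ring\<^esub> x = \<zero>\<^bsub>complex_ring\<^esub>" for x
      by (intro bexI[of _ "- x"]) (auto simp: complex_ring_def)
  qed (auto simp: complex_ring_def)
  show "comm_monoid complex_ring"
    by (rule comm_monoidI) (auto simp: complex_ring_def)
qed (auto simp: complex_ring_def algebra_simps)

context homogeneous_type_space
begin

lemma amalgam_space_fields:
  "\<zero>\<^bsub>amalgam_space M d q p \<alpha>\<^esub> = ae_class M (\<lambda>x. 0)"
  "F \<oplus>\<^bsub>amalgam_space M d q p \<alpha>\<^esub> G = class_add M F G"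
  "c \<odot>\<^bsub>amalgam_space M d q p \<alpha>\<^esub> F = class_smult M c F"
  by (simp_all add: amalgam_space_def)

lemma carrier_amalgam_space:
  "carrier (amalgam_space M d q p \<alpha>) =
    ae_class M ` {f \<in> borel_measurable (completion M). amalgam_norm M d q p \<alpha> f < \<infinity>}"
  by (auto simp: amalgam_space_def L0_def on_class_amalgam_norm)

lemma amalgam_spaceE:
  assumes "F \<in> carrier (amalgam_space M d q p \<alpha>)"
  obtains f where "f \<in> borel_measurable (completion M)" "amalgam_norm M d q p \<alpha> f < \<infinity>" "F = ae_class M f"
  using assms by (auto simp: carrier_amalgam_space)

lemma amalgam_spaceI:
  "\<lbrakk>f \<in> borel_measurable (completion M); amalgam_norm M d q p \<alpha> f < \<infinity>\<rbrakk> \<Longrightarrow>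
    ae_class M f \<in> carrier (amalgam_space M d q p \<alpha>)"
  by (auto simp: carrier_amalgam_space)

lemma add_in_carrier:
  assumes "1 \<le> q" "q \<le> p" "f \<in> borel_measurable (completion M)" "g \<in> borel_measurable (completion M)"
    "amalgam_norm M d q p \<alpha> f < \<infinity>" "amalgam_norm M d q p \<alpha> g < \<infinity>"
  shows "ae_class M (\<lambda>x. f x + g x) \<in> carrier (amalgam_space M d q p \<alpha>)"
proof (rule amalgam_spaceI)
  show "(\<lambda>x. f x + g x) \<in> borel_measurable (completion M)" using assms by measurable
  have "amalgam_norm M d q p \<alpha> f + amalgam_norm M d q p \<alpha> g < \<infinity>" using assms(5,6) by simp
  then show "amalgam_norm M d q p \<alpha> (\<lambda>x. f x + g x) < \<infinity>"
    by (rule le_less_trans[OF amalgam_norm_triangle[OF assms(1-4)]])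
qed

lemma smult_in_carrier:
  assumes "1 \<le> q" "q \<le> p" "f \<in> borel_measurable (completion M)" "amalgam_norm M d q p \<alpha> f < \<infinity>"
  shows "ae_class M (\<lambda>x. c * f x) \<in> carrier (amalgam_space M d q p \<alpha>)"
proof (rule amalgam_spaceI)
  show "(\<lambda>x. c * f x) \<in> borel_measurable (completion M)" using assms by measurable
  show "amalgam_norm M d q p \<alpha> (\<lambda>x. c * f x) < \<infinity>"
    using assms(4) by (simp add: amalgam_norm_cmult[OF assms(1-3)] ennreal_mult_less_top)
qed

lemma abelian_group_amalgam_space:
  assumes qp: "1 \<le> q" "q \<le> p"
  shows "abelian_group (amalgam_space M d q p \<alpha>)"
proof (rule abelian_groupI, unfold amalgam_space_fields)
  let ?V = "amalgam_space M d q p \<alpha>"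
  show "ae_class M (\<lambda>x. 0) \<in> carrier ?V"
    using amalgam_norm_zero[OF qp] by (intro amalgam_spaceI) auto
  fix F assume "F \<in> carrier ?V"
  then obtain f where f [measurable]: "f \<in> borel_measurable (completion M)"
    and f': "amalgam_norm M d q p \<alpha> f < \<infinity>" "F = ae_class M f"
    by (rule amalgam_spaceE)
  show "class_add M (ae_class M (\<lambda>x. 0)) F = F"
    unfolding f'(2) by (subst class_add_ae_class) auto
  have "class_add M (ae_class M (\<lambda>x. -1 * f x)) F = ae_class M (\<lambda>x. 0)"
    unfolding f'(2) by (subst class_add_ae_class) auto
  then show "\<exists>G\<in>carrier ?V. class_add M G F = ae_class M (\<lambda>x. 0)"
    using smult_in_carrier[OF qp f f'(1), of "-1"] by blast
  fix G assume "G \<in> carrier ?V"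
  then obtain g where g [measurable]: "g \<in> borel_measurable (completion M)"
    and g': "amalgam_norm M d q p \<alpha> g < \<infinity>" "G = ae_class M g"
    by (rule amalgam_spaceE)
  show "class_add M F G \<in> carrier ?V"
    unfolding f'(2) g'(2) class_add_ae_class[OF f g] using qp f g f'(1) g'(1) by (rule add_in_carrier)
  show "class_add M F G = class_add M G F"
    unfolding f'(2) g'(2) class_add_ae_class[OF f g] class_add_ae_class[OF g f] by (simp add: add.commute)
  fix H assume "H \<in> carrier ?V"
  then obtain h where h [measurable]: "h \<in> borel_measurable (completion M)" and h': "H = ae_class M h"
    by (rule amalgam_spaceE)
  have "(\<lambda>x. f x + g x) \<in> borel_measurable (completion M)" "(\<lambda>x. g x + h x) \<in> borel_measurable (completion M)"
    by measurable
  then show "class_add M (class_add M F G) H = class_add M F (class_add M G H)"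
    using f g h by (simp add: f'(2) g'(2) h' class_add_ae_class add.assoc)
qed

lemma module_amalgam_space:
  assumes qp: "1 \<le> q" "q \<le> p"
  shows "Module.module complex_ring (amalgam_space M d q p \<alpha>)"
proof (rule Module.moduleI[OF complex_ring_cring abelian_group_amalgam_space[OF qp]],
    unfold amalgam_space_fields)
  let ?V = "amalgam_space M d q p \<alpha>"
  fix a :: complex and F assume "F \<in> carrier ?V"
  then obtain f where f [measurable]: "f \<in> borel_measurable (completion M)"
    and f': "amalgam_norm M d q p \<alpha> f < \<infinity>" "F = ae_class M f"
    by (rule amalgam_spaceE)
  have cf: "(\<lambda>x. c * f x) \<in> borel_measurable (completion M)" for c by measurable
  show "class_smult M a F \<in> carrier ?V"
    unfolding f'(2) class_smult_ae_class[OF f] using qp f f'(1) by (rule smult_in_carrier)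
  show "class_smult M \<one>\<^bsub>complex_ring\<^esub> F = F"
    unfolding f'(2) class_smult_ae_class[OF f] by (simp add: complex_ring_def)
  show "class_smult M (a \<oplus>\<^bsub>complex_ring\<^esub> b) F = class_add M (class_smult M a F) (class_smult M b F)" for b
    unfolding f'(2) class_smult_ae_class[OF f] class_add_ae_class[OF cf cf]
    by (simp add: complex_ring_def distrib_right)
  show "class_smult M (a \<otimes>\<^bsub>complex_ring\<^esub> b) F = class_smult M a (class_smult M b F)" for b
    unfolding f'(2) class_smult_ae_class[OF f] class_smult_ae_class[OF cf]
    by (simp add: complex_ring_def mult.assoc)
  fix G assume "G \<in> carrier ?V"
  then obtain g where g [measurable]: "g \<in> borel_measurable (completion M)" and g': "G = ae_class M g"
    by (rule amalgam_spaceE)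
  have "(\<lambda>x. f x + g x) \<in> borel_measurable (completion M)" "(\<lambda>x. a * g x) \<in> borel_measurable (completion M)"
    by measurable
  then show "class_smult M a (class_add M F G) = class_add M (class_smult M a F) (class_smult M a G)"
    using f g cf by (simp add: f'(2) g' class_smult_ae_class class_add_ae_class distrib_left)
qed

lemma minus_amalgam_space:
  assumes qp: "1 \<le> q" "q \<le> p"
    and f: "f \<in> borel_measurable (completion M)" "amalgam_norm M d q p \<alpha> f < \<infinity>"
    and g: "g \<in> borel_measurable (completion M)" "amalgam_norm M d q p \<alpha> g < \<infinity>"
  shows "ae_class M f \<ominus>\<^bsub>amalgam_space M d q p \<alpha>\<^esub> ae_class M g = ae_class M (\<lambda>x. f x - g x)"
proof -
  let ?V = "amalgam_space M d q p \<alpha>"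
  interpret V: abelian_group ?V by (rule abelian_group_amalgam_space[OF qp])
  have mg: "(\<lambda>x. -1 * g x) \<in> borel_measurable (completion M)" using g by measurable
  have "\<ominus>\<^bsub>?V\<^esub> ae_class M g = ae_class M (\<lambda>x. -1 * g x)"
  proof (rule V.minus_equality)
    show "ae_class M (\<lambda>x. -1 * g x) \<oplus>\<^bsub>?V\<^esub> ae_class M g = \<zero>\<^bsub>?V\<^esub>"
      unfolding amalgam_space_fields class_add_ae_class[OF mg g(1)] by simp
  qed (use amalgam_spaceI[OF g] smult_in_carrier[OF qp g, of "-1"] in auto)
  then show ?thesis
    unfolding a_minus_def using class_add_ae_class[OF f(1) mg] by (simp add: amalgam_space_fields)
qed

lemma complex_banach_space_amalgam_space:
  assumes qp: "1 \<le> q" "q \<le> \<alpha>" "\<alpha> \<le> p"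
  shows "complex_banach_space (amalgam_space M d q p \<alpha>)
    (\<lambda>F. enn2real (on_class (amalgam_norm M d q p \<alpha>) F))"
proof -
  let ?V = "amalgam_space M d q p \<alpha>" and ?N = "amalgam_norm M d q p \<alpha>"
  let ?norm = "\<lambda>F. enn2real (on_class ?N F)"
  have qp': "q \<le> p" using qp by simp
  have norm_eq: "?norm (ae_class M f) = enn2real (?N f)" if "f \<in> borel_measurable (completion M)" for f
    using that by (simp add: on_class_amalgam_norm)
  have fin: "(?N (\<lambda>x. f x - g x)) < \<infinity>"
    if "f \<in> borel_measurable (completion M)" "?N f < \<infinity>"
      "g \<in> borel_measurable (completion M)" "?N g < \<infinity>" for f g
  proof -
    have mg: "(\<lambda>x. -1 * g x) \<in> borel_measurable (completion M)" using that by measurable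
    have "?N (\<lambda>x. f x - g x) \<le> ?N f + ?N (\<lambda>x. -1 * g x)"
      using amalgam_norm_triangle[OF qp(1) qp' that(1) mg] by simp
    also have "\<dots> < \<infinity>" using that by (subst amalgam_norm_cmult[OF qp(1) qp']) auto
    finally show ?thesis .
  qed
  have "?norm F = 0 \<longleftrightarrow> F = \<zero>\<^bsub>?V\<^esub>" if "F \<in> carrier ?V" for F
  proof -
    from that obtain f where f: "f \<in> borel_measurable (completion M)" "?N f < \<infinity>" "F = ae_class M f"
      by (rule amalgam_spaceE)
    have "?N f = 0 \<longleftrightarrow> ae_class M f = ae_class M (\<lambda>x. 0)"
    proof
      assume "?N f = 0"
      then show "ae_class M f = ae_class M (\<lambda>x. 0)"
        by (intro ae_class_cong amalgam_norm_eq_0D[OF qp f(1)])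
    next
      assume "ae_class M f = ae_class M (\<lambda>x. 0)"
      then have "on_class ?N (ae_class M f) = on_class ?N (ae_class M (\<lambda>x. 0))" by simp
      then show "?N f = 0" using f(1) amalgam_norm_zero[OF qp(1) qp'] by (simp add: on_class_amalgam_norm)
    qed
    moreover have "enn2real (?N f) = 0 \<longleftrightarrow> ?N f = 0" using f(2) by (auto simp: enn2real_eq_0_iff)
    ultimately show ?thesis using f by (simp add: norm_eq amalgam_space_fields)
  qed
  moreover have "?norm (c \<odot>\<^bsub>?V\<^esub> F) = cmod c * ?norm F" if "F \<in> carrier ?V" for c F
  proof -
    from that obtain f where f: "f \<in> borel_measurable (completion M)" "F = ae_class M f"
      by (rule amalgam_spaceE)
    have cf: "(\<lambda>x. c * f x) \<in> borel_measurable (completion M)" using f(1) by measurable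
    show ?thesis
      unfolding amalgam_space_fields f(2) class_smult_ae_class[OF f(1)] norm_eq[OF f(1)] norm_eq[OF cf]
        amalgam_norm_cmult[OF qp(1) qp' f(1)]
      by (simp add: enn2real_mult)
  qed
  moreover have "?norm (F \<oplus>\<^bsub>?V\<^esub> G) \<le> ?norm F + ?norm G" if "F \<in> carrier ?V" "G \<in> carrier ?V" for F G
  proof -
    from that(1) obtain f where f: "f \<in> borel_measurable (completion M)" "?N f < \<infinity>" "F = ae_class M f"
      by (rule amalgam_spaceE)
    from that(2) obtain g where g: "g \<in> borel_measurable (completion M)" "?N g < \<infinity>" "G = ae_class M g"
      by (rule amalgam_spaceE)
    have fg: "(\<lambda>x. f x + g x) \<in> borel_measurable (completion M)" using f(1) g(1) by measurable
    have "enn2real (?N (\<lambda>x. f x + g x)) \<le> enn2real (?N f + ?N g)"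
      using amalgam_norm_triangle[OF qp(1) qp' f(1) g(1)] f(2) g(2) by (intro enn2real_mono) auto
    also have "\<dots> = enn2real (?N f) + enn2real (?N g)" using f(2) g(2) by (intro enn2real_plus) auto
    finally show ?thesis
      unfolding amalgam_space_fields f(3) g(3) class_add_ae_class[OF f(1) g(1)]
        norm_eq[OF f(1)] norm_eq[OF g(1)] norm_eq[OF fg] .
  qed
  moreover have "\<exists>v\<in>carrier ?V. (\<lambda>n. ?norm (\<sigma> n \<ominus>\<^bsub>?V\<^esub> v)) \<longlonglongrightarrow> 0"
    if \<sigma>: "range \<sigma> \<subseteq> carrier ?V"
      and Cauchy: "\<forall>\<epsilon>>0. \<exists>K. \<forall>m\<ge>K. \<forall>n\<ge>K. ?norm (\<sigma> m \<ominus>\<^bsub>?V\<^esub> \<sigma> n) < \<epsilon>" for \<sigma> :: "nat \<Rightarrow> _"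
  proof -
    have "\<forall>n. \<exists>f. f \<in> borel_measurable (completion M) \<and> ?N f < \<infinity> \<and> \<sigma> n = ae_class M f"
      using \<sigma> amalgam_spaceE by (metis range_subsetD)
    then obtain f where f: "\<And>n. f n \<in> borel_measurable (completion M)" "\<And>n. ?N (f n) < \<infinity>"
      "\<And>n. \<sigma> n = ae_class M (f n)"
      by metis
    have norm_diff: "?norm (\<sigma> m \<ominus>\<^bsub>?V\<^esub> ae_class M g) = enn2real (?N (\<lambda>x. f m x - g x))"
      if "g \<in> borel_measurable (completion M)" "?N g < \<infinity>" for m g
      unfolding f(3) minus_amalgam_space[OF qp(1) qp' f(1) f(2) that]
      using f(1) that(1) by (intro norm_eq) measurable
    have "\<exists>K. \<forall>m\<ge>K. \<forall>n\<ge>K. ?N (\<lambda>x. f m x - f n x) \<le> ennreal \<epsilon>" if \<epsilon>: "0 < \<epsilon>" for \<epsilon>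
    proof -
      obtain K where K: "\<And>m n. K \<le> m \<Longrightarrow> K \<le> n \<Longrightarrow> ?norm (\<sigma> m \<ominus>\<^bsub>?V\<^esub> \<sigma> n) < \<epsilon>"
        using Cauchy \<epsilon> by blast
      have "?N (\<lambda>x. f m x - f n x) \<le> ennreal \<epsilon>" if "K \<le> m" "K \<le> n" for m n
      proof -
        have "enn2real (?N (\<lambda>x. f m x - f n x)) \<le> \<epsilon>"
          using K[OF that] unfolding f(3)[of n] norm_diff[OF f(1) f(2)] by simp
        then have "ennreal (enn2real (?N (\<lambda>x. f m x - f n x))) \<le> ennreal \<epsilon>" by (rule ennreal_leI)
        then show ?thesis using fin[OF f(1) f(2) f(1) f(2)] by simp
      qed
      then show ?thesis by blast
    qed
    from amalgam_norm_complete[OF qp f(1) this] obtain g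
      where g: "g \<in> borel_measurable (completion M)"
        and lim: "\<And>\<epsilon>. 0 < \<epsilon> \<Longrightarrow> \<exists>K. \<forall>n\<ge>K. ?N (\<lambda>x. f n x - g x) \<le> ennreal \<epsilon>"
      by blast
    obtain K where K: "?N (\<lambda>x. f K x - g x) \<le> ennreal 1" using lim[of 1] by auto
    have Ng: "?N g < \<infinity>"
    proof -
      have gK: "(\<lambda>x. g x - f K x) \<in> borel_measurable (completion M)" using g f(1) by measurable
      have "?N g \<le> ?N (\<lambda>x. g x - f K x) + ?N (f K)"
        using amalgam_norm_triangle[OF qp(1) qp' gK f(1)[of K]] by simp
      also have "\<dots> \<le> ennreal 1 + ?N (f K)"
        using K amalgam_norm_diff_commute[OF qp(1) qp' g f(1)[of K]] by (intro add_right_mono) simp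
      also have "\<dots> < \<infinity>" using f(2)[of K] by simp
      finally show ?thesis .
    qed
    have "(\<lambda>n. ?norm (\<sigma> n \<ominus>\<^bsub>?V\<^esub> ae_class M g)) \<longlonglongrightarrow> 0"
      unfolding norm_diff[OF g Ng]
    proof (rule LIMSEQ_I)
      fix \<epsilon> :: real assume "0 < \<epsilon>"
      then obtain K where K: "\<And>n. K \<le> n \<Longrightarrow> ?N (\<lambda>x. f n x - g x) \<le> ennreal (\<epsilon> / 2)"
        using lim[of "\<epsilon> / 2"] by auto
      have "norm (enn2real (?N (\<lambda>x. f n x - g x)) - 0) < \<epsilon>" if "K \<le> n" for n
        using enn2real_leI[OF _ K[OF that]] \<open>0 < \<epsilon>\<close> by simp
      then show "\<exists>no. \<forall>n\<ge>no. norm (enn2real (?N (\<lambda>x. f n x - g x)) - 0) < \<epsilon>" by blast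
    qed
    with amalgam_spaceI[OF g Ng] show ?thesis by blast
  qed
  ultimately show ?thesis
    unfolding complex_banach_space_def using module_amalgam_space[OF qp(1) qp'] by simp
qed

end

theorem theorem2p8:
  fixes M :: "'a measure" and d :: "'a \<Rightarrow> 'a \<Rightarrow> real"
  assumes "homogeneous_type_space M d"
  shows
    "(\<forall>q \<alpha> p :: ennreal. 1 \<le> q \<and> q \<le> \<alpha> \<and> \<alpha> \<le> p \<longrightarrow>
        complex_banach_space (amalgam_space M d q p \<alpha>)
          (\<lambda>F. enn2real (on_class (amalgam_norm M d q p \<alpha>) F)) \<and>
        (\<exists>C::real. C > 0 \<and> (\<forall>F\<in>L0 M.
          on_class (amalgam_norm M d q p \<alpha>) F
            \<le> ennreal C * on_class (Lnorm (completion M) \<alpha>) F)))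
     \<and>
     (\<forall>q \<alpha> p q\<^sub>1 q\<^sub>2 p\<^sub>1 p\<^sub>2 :: ennreal.
        1 \<le> q \<and> q \<le> \<alpha> \<and> \<alpha> \<le> p \<and>
        1 \<le> q\<^sub>1 \<and> q\<^sub>1 < q\<^sub>2 \<and> q\<^sub>2 \<le> \<alpha> \<and> \<alpha> \<le> p\<^sub>1 \<and> p\<^sub>1 < p\<^sub>2 \<longrightarrow>
        (\<exists>C::real. C > 0 \<and> (\<forall>F\<in>L0 M.
          on_class (amalgam_norm M d q\<^sub>1 p \<alpha>) F
            \<le> ennreal C * on_class (amalgam_norm M d q\<^sub>2 p \<alpha>) F \<and>
          on_class (amalgam_norm M d q p\<^sub>2 \<alpha>) F
            \<le> ennreal C * on_class (amalgam_norm M d q p\<^sub>1 \<alpha>) F)))"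
proof -
  interpret homogeneous_type_space M d by (rule assms)
  note on_class = on_class_amalgam_norm on_class_Lnorm
  show ?thesis
  proof (intro conjI allI impI, goal_cases)
    case (1 q \<alpha> p)
    then show ?case by (intro complex_banach_space_amalgam_space) auto
  next
    case (2 q \<alpha> p)
    then show ?case
      using amalgam_norm_le_Lnorm[of q \<alpha> p] by (auto simp: L0_def on_class)
  next
    case (3 q \<alpha> p q\<^sub>1 q\<^sub>2 p\<^sub>1 p\<^sub>2)
    then have order: "1 \<le> q" "q \<le> \<alpha>" "\<alpha> \<le> p\<^sub>1" "p\<^sub>1 \<le> p\<^sub>2" "1 \<le> q\<^sub>1" "q\<^sub>1 \<le> q\<^sub>2" "1 \<le> p" by auto
    obtain C where C: "0 < C" "\<And>f. f \<in> borel_measurable (completion M) \<Longrightarrow>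
        amalgam_norm M d q p\<^sub>2 \<alpha> f \<le> ennreal C * amalgam_norm M d q p\<^sub>1 \<alpha> f"
      using amalgam_norm_mono_p[OF order(1-4)] by blast
    have "amalgam_norm M d q\<^sub>1 p \<alpha> f \<le> ennreal (max 1 C) * amalgam_norm M d q\<^sub>2 p \<alpha> f \<and>
        amalgam_norm M d q p\<^sub>2 \<alpha> f \<le> ennreal (max 1 C) * amalgam_norm M d q p\<^sub>1 \<alpha> f"
      if f: "f \<in> borel_measurable (completion M)" for f
    proof
      have "amalgam_norm M d q\<^sub>1 p \<alpha> f \<le> ennreal 1 * amalgam_norm M d q\<^sub>2 p \<alpha> f"
        using amalgam_norm_mono_q[OF order(5-7) f] by simp
      also have "\<dots> \<le> ennreal (max 1 C) * amalgam_norm M d q\<^sub>2 p \<alpha> f"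
        by (intro mult_right_mono ennreal_leI) auto
      finally show "amalgam_norm M d q\<^sub>1 p \<alpha> f \<le> ennreal (max 1 C) * amalgam_norm M d q\<^sub>2 p \<alpha> f" .
      have "amalgam_norm M d q p\<^sub>2 \<alpha> f \<le> ennreal C * amalgam_norm M d q p\<^sub>1 \<alpha> f" by (rule C(2)[OF f])
      also have "\<dots> \<le> ennreal (max 1 C) * amalgam_norm M d q p\<^sub>1 \<alpha> f"
        by (intro mult_right_mono ennreal_leI) auto
      finally show "amalgam_norm M d q p\<^sub>2 \<alpha> f \<le> ennreal (max 1 C) * amalgam_norm M d q p\<^sub>1 \<alpha> f" .
    qed
    then show ?case by (intro exI[of _ "max 1 C"]) (auto simp: L0_def on_class)
  qed
qed

end
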